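(* Consider a state-dependent discrete memoryless channel $W_{Y,Z|X,S}$ with finite alphabets, i.i.d. state distribution $Q_S$, innocent symbol $x_0$, and non-causal channel state information available only at the transmitter (encoder $(M,S^n)\mapsto X^n$, decoder $Y^n\mapsto\hat M$). Let $\mathcal D$ be the set of joint pmfs $$P_{U,V,S,X,Y,Z}=P_UP_VP_{S|U,V}\mathbb 1_{\{X=x(U,S)\}}W_{Y,Z|X,S},$$ where $U,V$ are auxiliary random variables on finite alphabets with $|\mathcal U|\le|\mathcal X|+5$, $|\mathcal V|\le|\mathcal X|+3$, $x:\mathcal U\times\mathcal S\to\mathcal X$ is deterministic, such that $Q_S(s)=\sum_{u,v}P_U(u)P_V(v)P_{S|U,V}(s|u,v)$, $P_Z=Q_0$, and $\mathbb I(V;Y|U)>\max\{\mathbb I(V;Z),\ \mathbb I(U,V;Z)-\mathbb I(U;Y)\}$. Let $$\mathcal S=\{R\ge0:\exists P\in\mathcal D \text{ with } R\le \mathbb I(U;Y)-\max\{\mathbb I(U;S),\ \mathbb I(U,V;S)-\mathbb I(V;Y|U)\}\}.$$ Then the covert capacity satisfies $C_{\mathrm{NC\text{-}T}}\ge\max\{x:x\in\mathcal S\}$.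
   Context: Finite alphabets $\mathcal S,\mathcal X,\mathcal Y,\mathcal Z$. The channel has transition pmf $W_{Y,Z|X,S}$: input $X$, state $S$, output $Y$ at the legitimate receiver and output $Z$ at an adversary (warden). The state sequence $S^n$ is i.i.d. with pmf $Q_S$ and independent of the message; neither the legitimate receiver nor the warden knows the state. $x_0\in\mathcal X$ is a fixed innocent symbol, and $Q_0(z)=\sum_{s}Q_S(s)W_{Z|X,S}(z|x_0,s)$, assumed to have full support on $\mathcal Z$. A $(2^{nR},n)$ code consists of a message $M$ uniform on $\{1,\dots,2^{nR}\}$, an encoder and a decoder of the type specified. $P_{Z^n}$ denotes the distribution of the warden's output induced by the code. A rate $R$ is achievable if there is a sequence of $(2^{nR},n)$ codes with $\mathbb P(\hat M\ne M)\to 0$ and $\mathbb D(P_{Z^n}\|Q_0^{\otimes n})\to 0$ as $n\to\infty$; the covert capacity is the supremum of achievable rates. Mutual informations are computed under the indicated joint pmf. *)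

theory Defs
  imports "HOL-Probability.Probability"
begin

primrec iid_pmf :: "nat \<Rightarrow> 'a pmf \<Rightarrow> 'a list pmf" where
  "iid_pmf 0 p = return_pmf []"
| "iid_pmf (Suc n) p = bind_pmf p (\<lambda>a. map_pmf (\<lambda>xs. a # xs) (iid_pmf n p))"

fun chan_seq :: "('x \<Rightarrow> 's \<Rightarrow> ('y \<times> 'z) pmf) \<Rightarrow> 'x list \<Rightarrow> 's list \<Rightarrow> ('y list \<times> 'z list) pmf" where
  "chan_seq W (x # xs) (s # ss) =
     bind_pmf (W x s) (\<lambda>(y, z). map_pmf (\<lambda>(ys, zs). (y # ys, z # zs)) (chan_seq W xs ss))"
| "chan_seq W _ _ = return_pmf ([], [])"

definition innocent_out :: "'s pmf \<Rightarrow> ('x \<Rightarrow> 's \<Rightarrow> ('y \<times> 'z) pmf) \<Rightarrow> 'x \<Rightarrow> 'z pmf" where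
  "innocent_out QS W x0 = bind_pmf QS (\<lambda>s. map_pmf snd (W x0 s))"

text \<open>Relative entropy (natural log) of pmfs with finite support of the first argument;
  infinite if P is not absolutely continuous w.r.t. Q.\<close>
definition KL_div :: "'a pmf \<Rightarrow> 'a pmf \<Rightarrow> ereal" where
  "KL_div P Q = (if set_pmf P \<subseteq> set_pmf Q
      then ereal (\<Sum>a\<in>set_pmf P. pmf P a * ln (pmf P a / pmf Q a)) else \<infinity>)"

definition num_msgs :: "nat \<Rightarrow> real \<Rightarrow> nat" where
  "num_msgs n R = nat \<lceil>2 powr (real n * R)\<rceil>"

definition nct_code_dist ::
  "nat \<Rightarrow> nat \<Rightarrow> 's pmf \<Rightarrow> ('x \<Rightarrow> 's \<Rightarrow> ('y \<times> 'z) pmf) \<Rightarrow> (nat \<Rightarrow> 's list \<Rightarrow> 'x list)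
   \<Rightarrow> (nat \<times> 'y list \<times> 'z list) pmf" where
  "nct_code_dist n K QS W enc =
     bind_pmf (pmf_of_set {..<K}) (\<lambda>m.
     bind_pmf (iid_pmf n QS) (\<lambda>s.
     map_pmf (\<lambda>(y, z). (m, y, z)) (chan_seq W (enc m s) s)))"

definition nct_error_prob ::
  "nat \<Rightarrow> nat \<Rightarrow> 's pmf \<Rightarrow> ('x \<Rightarrow> 's \<Rightarrow> ('y \<times> 'z) pmf) \<Rightarrow> (nat \<Rightarrow> 's list \<Rightarrow> 'x list)
   \<Rightarrow> ('y list \<Rightarrow> nat) \<Rightarrow> real" where
  "nct_error_prob n K QS W enc dec =
     measure_pmf.prob (nct_code_dist n K QS W enc) {(m, y, z). dec y \<noteq> m}"

definition nct_warden_dist ::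
  "nat \<Rightarrow> nat \<Rightarrow> 's pmf \<Rightarrow> ('x \<Rightarrow> 's \<Rightarrow> ('y \<times> 'z) pmf) \<Rightarrow> (nat \<Rightarrow> 's list \<Rightarrow> 'x list)
   \<Rightarrow> 'z list pmf" where
  "nct_warden_dist n K QS W enc = map_pmf (\<lambda>(m, y, z). z) (nct_code_dist n K QS W enc)"

definition covert_achievable_NCT ::
  "'s pmf \<Rightarrow> ('x \<Rightarrow> 's \<Rightarrow> ('y \<times> 'z) pmf) \<Rightarrow> 'x \<Rightarrow> real \<Rightarrow> bool" where
  "covert_achievable_NCT QS W x0 R \<longleftrightarrow>
     (\<exists>(enc :: nat \<Rightarrow> nat \<Rightarrow> 's list \<Rightarrow> 'x list) (dec :: nat \<Rightarrow> 'y list \<Rightarrow> nat).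
        (\<forall>n m s. length s = n \<longrightarrow> length (enc n m s) = n) \<and>
        (\<lambda>n. nct_error_prob n (num_msgs n R) QS W (enc n) (dec n)) \<longlonglongrightarrow> 0 \<and>
        (\<lambda>n. KL_div (nct_warden_dist n (num_msgs n R) QS W (enc n))
                     (iid_pmf n (innocent_out QS W x0))) \<longlonglongrightarrow> 0)"

definition covert_capacity_NCT ::
  "'s pmf \<Rightarrow> ('x \<Rightarrow> 's \<Rightarrow> ('y \<times> 'z) pmf) \<Rightarrow> 'x \<Rightarrow> ereal" where
  "covert_capacity_NCT QS W x0 = Sup {ereal R | R. covert_achievable_NCT QS W x0 R}"

definition mutual_inf :: "'w pmf \<Rightarrow> ('w \<Rightarrow> 'a) \<Rightarrow> ('w \<Rightarrow> 'b) \<Rightarrow> real" where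
  "mutual_inf p F G =
    (let pab = map_pmf (\<lambda>w. (F w, G w)) p; pa = map_pmf F p; pb = map_pmf G p in
     \<Sum>(a, b)\<in>set_pmf pab. pmf pab (a, b) * log 2 (pmf pab (a, b) / (pmf pa a * pmf pb b)))"

definition cond_mutual_inf ::
  "'w pmf \<Rightarrow> ('w \<Rightarrow> 'a) \<Rightarrow> ('w \<Rightarrow> 'b) \<Rightarrow> ('w \<Rightarrow> 'c) \<Rightarrow> real" where
  "cond_mutual_inf p F G H =
    (let pabc = map_pmf (\<lambda>w. (F w, G w, H w)) p;
         pac = map_pmf (\<lambda>w. (F w, H w)) p; pbc = map_pmf (\<lambda>w. (G w, H w)) p;
         pc = map_pmf H p in
     \<Sum>(a, b, c)\<in>set_pmf pabc.
        pmf pabc (a, b, c) * log 2 (pmf pabc (a, b, c) * pmf pc c / (pmf pac (a, c) * pmf pbc (b, c))))"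

text \<open>Joint pmf P_U P_V P_{S|U,V} 1{X = x(U,S)} W_{Y,Z|X,S} on (U,V,S,X,Y,Z);
  auxiliary alphabets are encoded as initial segments of nat.\<close>
definition nct_joint ::
  "nat pmf \<Rightarrow> nat pmf \<Rightarrow> (nat \<Rightarrow> nat \<Rightarrow> 's pmf) \<Rightarrow> (nat \<Rightarrow> 's \<Rightarrow> 'x)
   \<Rightarrow> ('x \<Rightarrow> 's \<Rightarrow> ('y \<times> 'z) pmf) \<Rightarrow> (nat \<times> nat \<times> 's \<times> 'x \<times> 'y \<times> 'z) pmf" where
  "nct_joint PU PV PS xf W =
     bind_pmf PU (\<lambda>u. bind_pmf PV (\<lambda>v. bind_pmf (PS u v) (\<lambda>s.
       map_pmf (\<lambda>(y, z). (u, v, s, xf u s, y, z)) (W (xf u s) s))))"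

abbreviation "jU \<equiv> (\<lambda>(u, v, s, x, y, z). u)"
abbreviation "jV \<equiv> (\<lambda>(u, v, s, x, y, z). v)"
abbreviation "jS \<equiv> (\<lambda>(u, v, s, x, y, z). s)"
abbreviation "jY \<equiv> (\<lambda>(u, v, s, x, y, z). y)"
abbreviation "jZ \<equiv> (\<lambda>(u, v, s, x, y, z). z)"
abbreviation "jUV \<equiv> (\<lambda>(u, v, s, x, y, z). (u, v))"

definition in_D_NCT ::
  "'s pmf \<Rightarrow> ('x \<Rightarrow> 's \<Rightarrow> ('y \<times> 'z) pmf) \<Rightarrow> 'x
   \<Rightarrow> nat pmf \<Rightarrow> nat pmf \<Rightarrow> (nat \<Rightarrow> nat \<Rightarrow> 's pmf) \<Rightarrow> (nat \<Rightarrow> 's \<Rightarrow> 'x) \<Rightarrow> bool" where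
  "in_D_NCT QS W x0 PU PV PS xf \<longleftrightarrow>
     (let P = nct_joint PU PV PS xf W in
       set_pmf PU \<subseteq> {..<CARD('x) + 5} \<and>
       set_pmf PV \<subseteq> {..<CARD('x) + 3} \<and>
       map_pmf jS P = QS \<and>
       map_pmf jZ P = innocent_out QS W x0 \<and>
       cond_mutual_inf P jV jY jU >
         max (mutual_inf P jV jZ) (mutual_inf P jUV jZ - mutual_inf P jU jY))"

definition rate_set_NCT :: "'s pmf \<Rightarrow> ('x \<Rightarrow> 's \<Rightarrow> ('y \<times> 'z) pmf) \<Rightarrow> 'x \<Rightarrow> real set" where
  "rate_set_NCT QS W x0 = {R. R \<ge> 0 \<and>
     (\<exists>PU PV PS xf. in_D_NCT QS W x0 PU PV PS xf \<and>
        (let P = nct_joint PU PV PS xf W in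
          R \<le> mutual_inf P jU jY
               - max (mutual_inf P jU jS) (mutual_inf P jUV jS - cond_mutual_inf P jV jY jU)))}"

end

theory Submission
  imports Defs
begin

text \<open>
  Put \<open>T = (U, V)\<close>. By the chain rule \<open>I(T;Y) = I(U;Y) + I(V;Y|U)\<close>, so every rate in question is
  at most \<open>I(T;Y) - I(T;S)\<close>, and the condition defining the admissible joint laws gives
  \<open>I(T;Y) > I(T;Z)\<close>. Hence one block of Gelfand--Pinsker coding with the auxiliary variable \<open>T\<close>
  suffices; neither block-Markov coding nor a key extracted from \<open>V\<close> is needed.

  Draw codewords \<open>t(m,l)\<close> i.i.d. with \<open>R + R_l\<close> just below \<open>I(T;Y)\<close> and \<open>R_l\<close> just above \<open>I(T;S)\<close>.
  In the ideal experiment \<open>(m,l)\<close> is uniform and the state is produced from the codeword. Soft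
  covering over \<open>l\<close> makes the ideal law of \<open>(m,s)\<close> close to the true one, soft covering over \<open>(m,l)\<close>
  makes the law of \<open>Z^n\<close> close to \<open>Q_0^n\<close>, and a threshold decoder recovers \<open>m\<close>. The encoder must be
  a function of \<open>(m,s)\<close>, so \<open>l\<close> is sampled once for each pair \<open>(m,s)\<close> from its ideal conditional
  law, and a third use of soft covering shows that some sample leaves the law of \<open>Z^n\<close> almost
  unchanged. All errors decay exponentially, which beats the factor \<open>O(n)\<close> lost in passing from
  total variation to relative entropy.
\<close>

section \<open>Finitely supported probability mass functions\<close>

abbreviation expct :: "'a pmf \<Rightarrow> ('a \<Rightarrow> real) \<Rightarrow> real" where
  "expct p f \<equiv> measure_pmf.expectation p f"

abbreviation prob :: "'a pmf \<Rightarrow> 'a set \<Rightarrow> real" where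
  "prob p A \<equiv> measure_pmf.prob p A"

lemma expct_add:
  "finite (set_pmf p) \<Longrightarrow> expct p (\<lambda>x. f x + g x) = expct p f + expct p g"
  by (simp add: integrable_measure_pmf_finite)

lemma expct_diff:
  "finite (set_pmf p) \<Longrightarrow> expct p (\<lambda>x. f x - g x) = expct p f - expct p g"
  by (simp add: integrable_measure_pmf_finite)

lemma expct_sum:
  "finite (set_pmf p) \<Longrightarrow> expct p (\<lambda>x. \<Sum>i\<in>I. f i x) = (\<Sum>i\<in>I. expct p (f i))"
  by (rule Bochner_Integration.integral_sum) (simp add: integrable_measure_pmf_finite)

lemma expct_cong:
  "(\<And>x. x \<in> set_pmf p \<Longrightarrow> f x = g x) \<Longrightarrow> expct p f = expct p g"
  by (intro integral_cong_AE) (auto simp: AE_measure_pmf_iff)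

lemma expct_mono:
  assumes "finite (set_pmf p)" "\<And>x. x \<in> set_pmf p \<Longrightarrow> f x \<le> g x"
  shows "expct p f \<le> expct p g"
  using assms by (intro integral_mono_AE)
    (auto simp: integrable_measure_pmf_finite AE_measure_pmf_iff)

lemma expct_eq_sum:
  assumes "finite A" "set_pmf p \<subseteq> A"
  shows "expct p f = (\<Sum>a\<in>A. pmf p a * f a)"
  using assms by (subst integral_measure_pmf[of A]) auto

lemma expct_bind:
  assumes "finite (set_pmf p)" "\<And>x. x \<in> set_pmf p \<Longrightarrow> finite (set_pmf (f x))"
  shows "expct (bind_pmf p f) h = expct p (\<lambda>x. expct (f x) h)"
  using assms by (subst pmf_expectation_bind[of "set_pmf p"]) (auto simp: expct_eq_sum)

lemma ex_le_expct:
  assumes "finite (set_pmf p)"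
  shows "\<exists>x\<in>set_pmf p. f x \<le> expct p f"
proof (rule ccontr)
  assume "\<not> ?thesis"
  hence gt: "\<And>x. x \<in> set_pmf p \<Longrightarrow> f x > expct p f" by auto
  have "expct p f = (\<Sum>x\<in>set_pmf p. pmf p x * expct p f)"
    using assms by (simp add: sum_distrib_right[symmetric] sum_pmf_eq_1)
  also have "\<dots> < (\<Sum>x\<in>set_pmf p. pmf p x * f x)"
    using assms gt by (intro sum_strict_mono) (auto simp: set_pmf_not_empty pmf_positive)
  also have "\<dots> = expct p f"
    using assms by (simp add: expct_eq_sum)
  finally show False by simp
qed

lemma prob_eq_expct: "prob p A = expct p (\<lambda>x. of_bool (x \<in> A))"
proof -
  have "expct p (\<lambda>x. of_bool (x \<in> A)) = expct p (indicator A)"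
    by (rule expct_cong) (auto simp: indicator_def)
  thus ?thesis by simp
qed

lemma prob_eq_sum:
  assumes "finite A" "set_pmf p \<subseteq> A"
  shows "prob p X = (\<Sum>a\<in>A. pmf p a * of_bool (a \<in> X))"
  unfolding prob_eq_expct by (rule expct_eq_sum[OF assms])

lemma prob_bind:
  assumes "finite (set_pmf p)" "\<And>a. a \<in> set_pmf p \<Longrightarrow> finite (set_pmf (f a))"
  shows "prob (bind_pmf p f) X = expct p (\<lambda>a. prob (f a) X)"
  unfolding prob_eq_expct by (rule expct_bind[OF assms])

lemma pmf_bind_eq_sum:
  assumes "finite A" "set_pmf p \<subseteq> A"
  shows "pmf (bind_pmf p f) x = (\<Sum>a\<in>A. pmf p a * pmf (f a) x)"
  using assms by (simp add: pmf_bind expct_eq_sum)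

lemma pmf_mult_le_pmf_bind:
  assumes "finite (set_pmf p)"
  shows "pmf p a * pmf (f a) x \<le> pmf (bind_pmf p f) x"
proof -
  have "pmf p a * pmf (f a) x = (\<Sum>b\<in>{a}. pmf p b * pmf (f b) x)" by simp
  also have "\<dots> \<le> (\<Sum>b\<in>insert a (set_pmf p). pmf p b * pmf (f b) x)"
    using assms by (intro sum_mono2) auto
  also have "\<dots> = pmf (bind_pmf p f) x"
    using assms by (intro pmf_bind_eq_sum[symmetric]) auto
  finally show ?thesis .
qed

lemma sum_pmf_le_1: "finite A \<Longrightarrow> (\<Sum>a\<in>A. pmf p a) \<le> 1"
  by (simp add: measure_measure_pmf_finite[symmetric])

definition joint_pmf :: "'a pmf \<Rightarrow> ('a \<Rightarrow> 'b pmf) \<Rightarrow> ('a \<times> 'b) pmf" where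
  "joint_pmf p k = bind_pmf p (\<lambda>a. map_pmf (Pair a) (k a))"

lemma finite_set_joint_pmf:
  assumes "finite (set_pmf p)" "\<And>a. a \<in> set_pmf p \<Longrightarrow> finite (set_pmf (k a))"
  shows "finite (set_pmf (joint_pmf p k))"
  using assms by (simp add: joint_pmf_def)

lemma map_fst_joint_pmf: "map_pmf fst (joint_pmf p k) = p"
  by (simp add: joint_pmf_def map_bind_pmf pmf.map_comp o_def bind_return_pmf')

lemma map_snd_joint_pmf: "map_pmf snd (joint_pmf p k) = bind_pmf p k"
  by (simp add: joint_pmf_def map_bind_pmf pmf.map_comp o_def)

lemma pmf_joint_pmf: "pmf (joint_pmf p k) (a, b) = pmf p a * pmf (k a) b"
proof -
  have "pmf (map_pmf (Pair a') (k a')) (a, b) = indicator {a} a' * pmf (k a) b" for a'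
    by (cases "a' = a") (auto simp: pmf_map_inj' inj_on_def pmf_eq_0_set_pmf)
  thus ?thesis by (simp add: joint_pmf_def pmf_bind pmf.rep_eq[of p])
qed

lemma bind_joint_pmf: "bind_pmf (joint_pmf p k) w = bind_pmf p (\<lambda>a. bind_pmf (k a) (\<lambda>b. w (a, b)))"
  by (simp add: joint_pmf_def bind_assoc_pmf bind_map_pmf)

lemma expct_joint_pmf:
  assumes "finite (set_pmf p)" "\<And>a. a \<in> set_pmf p \<Longrightarrow> finite (set_pmf (k a))"
  shows "expct (joint_pmf p k) h = expct p (\<lambda>a. expct (k a) (\<lambda>b. h (a, b)))"
  unfolding joint_pmf_def using assms by (simp add: expct_bind)

lemma prob_joint_pmf:
  assumes "finite (set_pmf p)" "\<And>a. a \<in> set_pmf p \<Longrightarrow> finite (set_pmf (k a))"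
  shows "prob (joint_pmf p k) X = expct p (\<lambda>a. prob (k a) {b. (a, b) \<in> X})"
  unfolding prob_eq_expct by (simp add: expct_joint_pmf[OF assms])

lemma conditional_kernelE:
  fixes r :: "('a \<times> 'b) pmf"
  obtains g where "\<And>a. set_pmf (g a) \<subseteq> snd ` set_pmf r" "joint_pmf (map_pmf fst r) g = r"
proof -
  let ?cond = "\<lambda>a. cond_pmf r {x. fst x = a}"
  define g where "g = (\<lambda>a. if a \<in> fst ` set_pmf r then map_pmf snd (?cond a) else map_pmf snd r)"
  have set_cond: "set_pmf (?cond a) = set_pmf r \<inter> {x. fst x = a}" if "a \<in> fst ` set_pmf r" for a
    using that by (intro set_cond_pmf) auto
  have "map_pmf (Pair a) (g a) = ?cond a" if "a \<in> fst ` set_pmf r" for a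
    unfolding g_def using that by (simp add: pmf.map_comp) (rule map_pmf_idI, auto simp: set_cond)
  hence "joint_pmf (map_pmf fst r) g = bind_pmf (map_pmf fst r) ?cond"
    unfolding joint_pmf_def by (intro bind_pmf_cong) auto
  also have "\<dots> = r"
  proof (rule bind_cond_pmf_cancel)
    fix a x assume "x \<in> set_pmf r" "fst x = a"
    thus "prob r {y. fst y = a} = prob (map_pmf fst r) {b. fst x = b}"
      by (auto simp: vimage_def intro!: arg_cong[where f = "prob r"])
  qed auto
  finally have "joint_pmf (map_pmf fst r) g = r" .
  moreover have "set_pmf (g a) \<subseteq> snd ` set_pmf r" for a
    using set_cond[of a] by (auto simp: g_def)
  ultimately show thesis by (intro that)
qed

definition l1_dist :: "'a pmf \<Rightarrow> 'a pmf \<Rightarrow> real" where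
  "l1_dist p q = (\<Sum>x\<in>set_pmf p \<union> set_pmf q. \<bar>pmf p x - pmf q x\<bar>)"

lemma l1_dist_eq_sum:
  assumes "finite A" "set_pmf p \<subseteq> A" "set_pmf q \<subseteq> A"
  shows "l1_dist p q = (\<Sum>x\<in>A. \<bar>pmf p x - pmf q x\<bar>)"
  unfolding l1_dist_def using assms by (intro sum.mono_neutral_left) (auto simp: set_pmf_iff)

lemma l1_dist_nonneg: "0 \<le> l1_dist p q"
  by (simp add: l1_dist_def sum_nonneg)

lemma l1_dist_commute: "l1_dist p q = l1_dist q p"
  by (simp add: l1_dist_def Un_commute abs_minus_commute)

lemma l1_dist_triangle:
  assumes "finite (set_pmf p)" "finite (set_pmf q)" "finite (set_pmf r)"
  shows "l1_dist p r \<le> l1_dist p q + l1_dist q r"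
proof -
  let ?A = "set_pmf p \<union> set_pmf q \<union> set_pmf r"
  have "(\<Sum>x\<in>?A. \<bar>pmf p x - pmf r x\<bar>) \<le> (\<Sum>x\<in>?A. \<bar>pmf p x - pmf q x\<bar> + \<bar>pmf q x - pmf r x\<bar>)"
    by (intro sum_mono) linarith
  thus ?thesis
    using assms by (simp add: l1_dist_eq_sum[of ?A] le_supI1 sum.distrib)
qed

lemma expct_le_expct_plus_l1_dist:
  assumes fin: "finite (set_pmf p)" "finite (set_pmf q)" and h_bounded: "\<And>x. \<bar>h x\<bar> \<le> 1"
  shows "expct p h \<le> expct q h + l1_dist p q"
proof -
  let ?A = "set_pmf p \<union> set_pmf q"
  have "expct p h - expct q h = (\<Sum>x\<in>?A. (pmf p x - pmf q x) * h x)"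
    using fin by (simp add: expct_eq_sum[of ?A] left_diff_distrib sum_subtractf)
  also have "\<dots> \<le> (\<Sum>x\<in>?A. \<bar>pmf p x - pmf q x\<bar>)"
  proof (rule sum_mono)
    fix x
    have "(pmf p x - pmf q x) * h x \<le> \<bar>pmf p x - pmf q x\<bar> * \<bar>h x\<bar>"
      by (metis abs_ge_self abs_mult)
    also have "\<dots> \<le> \<bar>pmf p x - pmf q x\<bar>"
      using h_bounded by (intro mult_right_le_one_le) auto
    finally show "(pmf p x - pmf q x) * h x \<le> \<bar>pmf p x - pmf q x\<bar>" .
  qed
  finally show ?thesis by (simp add: l1_dist_def)
qed

lemma l1_dist_bind_le:
  assumes fin: "finite (set_pmf p)" "finite (set_pmf q)"
    and fin_f: "\<And>x. x \<in> set_pmf p \<union> set_pmf q \<Longrightarrow> finite (set_pmf (f x))"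
  shows "l1_dist (bind_pmf p f) (bind_pmf q f) \<le> l1_dist p q"
proof -
  let ?A = "set_pmf p \<union> set_pmf q"
  let ?B = "\<Union>x\<in>?A. set_pmf (f x)"
  have fin_B: "finite ?B" using fin fin_f by auto
  have "l1_dist (bind_pmf p f) (bind_pmf q f) = (\<Sum>y\<in>?B. \<bar>\<Sum>x\<in>?A. (pmf p x - pmf q x) * pmf (f x) y\<bar>)"
    using fin by (subst l1_dist_eq_sum[OF fin_B])
      (auto simp: pmf_bind_eq_sum[of ?A] left_diff_distrib sum_subtractf)
  also have "\<dots> \<le> (\<Sum>y\<in>?B. \<Sum>x\<in>?A. \<bar>pmf p x - pmf q x\<bar> * pmf (f x) y)"
    by (intro sum_mono order_trans[OF sum_abs]) (simp add: abs_mult)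
  also have "\<dots> = (\<Sum>x\<in>?A. \<bar>pmf p x - pmf q x\<bar> * (\<Sum>y\<in>?B. pmf (f x) y))"
    by (subst sum.swap) (simp add: sum_distrib_left)
  also have "\<dots> = l1_dist p q"
    unfolding l1_dist_def using fin_B by (intro sum.cong refl) (subst sum_pmf_eq_1; auto)
  finally show ?thesis .
qed

section \<open>Soft covering\<close>

lemma expct_abs_le_sqrt:
  assumes "finite (set_pmf p)"
  shows "expct p (\<lambda>x. \<bar>f x\<bar>) \<le> sqrt (expct p (\<lambda>x. (f x)\<^sup>2))"
proof (rule real_le_rsqrt)
  have "0 \<le> measure_pmf.variance p (\<lambda>x. \<bar>f x\<bar>)"
    by (rule measure_pmf.variance_positive)
  also have "\<dots> = expct p (\<lambda>x. \<bar>f x\<bar>\<^sup>2) - (expct p (\<lambda>x. \<bar>f x\<bar>))\<^sup>2"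
    using assms by (intro measure_pmf.variance_eq) (auto simp: integrable_measure_pmf_finite)
  finally show "(expct p (\<lambda>x. \<bar>f x\<bar>))\<^sup>2 \<le> expct p (\<lambda>x. (f x)\<^sup>2)" by simp
qed

lemma finite_set_Pi_pmf:
  assumes "finite I" "\<And>i. i \<in> I \<Longrightarrow> finite (set_pmf (p i))"
  shows "finite (set_pmf (Pi_pmf I d p))"
  using assms by (simp add: set_Pi_pmf finite_PiE_dflt)

lemma expct_Pi_pmf_component:
  assumes "finite I" "i \<in> I"
  shows "expct (Pi_pmf I d p) (\<lambda>c. h (c i)) = expct (p i) h"
  using integral_map_pmf[of "\<lambda>c. c i" "Pi_pmf I d p" h] Pi_pmf_component[OF assms(1), of i d p]
    assms(2) by simp

lemma expct_Pi_pmf_expct: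
  assumes "finite (set_pmf \<rho>)" "\<And>i. i \<in> set_pmf \<rho> \<Longrightarrow> finite (set_pmf (p i))"
  shows "expct (Pi_pmf (set_pmf \<rho>) d p) (\<lambda>c. expct \<rho> (\<lambda>i. h i (c i)))
      = expct \<rho> (\<lambda>i. expct (p i) (h i))"
  using assms
  by (simp add: expct_eq_sum[OF assms(1) order_refl] expct_sum finite_set_Pi_pmf
      expct_Pi_pmf_component)

lemma expct_Pi_pmf_pair:
  assumes "finite I" "i \<in> I" "j \<in> I" "i \<noteq> j" "\<And>j. j \<in> I \<Longrightarrow> finite (set_pmf (p j))"
  shows "expct (Pi_pmf I d p) (\<lambda>c. h (c i) (c j)) = expct (p i) (\<lambda>x. expct (p j) (h x))"
proof -
  let ?P = "Pi_pmf (I - {i}) d p"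
  have fin: "finite (set_pmf ?P)"
    using assms by (intro finite_set_Pi_pmf) auto
  have "Pi_pmf (insert i (I - {i})) d p = bind_pmf (p i) (\<lambda>x. map_pmf (\<lambda>c. c(i := x)) ?P)"
    using assms(1) by (subst Pi_pmf_insert') (auto simp: map_pmf_def)
  hence "Pi_pmf I d p = bind_pmf (p i) (\<lambda>x. map_pmf (\<lambda>c. c(i := x)) ?P)"
    using assms(2) by (simp add: insert_absorb)
  hence "expct (Pi_pmf I d p) (\<lambda>c. h (c i) (c j)) = expct (p i) (\<lambda>x. expct ?P (\<lambda>c. h x (c j)))"
    using assms fin by (simp add: expct_bind)
  also have "\<dots> = expct (p i) (\<lambda>x. expct (p j) (h x))"
    using assms by (intro expct_cong expct_Pi_pmf_component) auto
  finally show ?thesis .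
qed

lemma variance_sum_Pi_pmf:
  assumes fin_I: "finite I" and fin_p: "\<And>i. i \<in> I \<Longrightarrow> finite (set_pmf (p i))"
  shows "expct (Pi_pmf I d p) (\<lambda>c. (\<Sum>i\<in>I. a i (c i) - expct (p i) (a i))\<^sup>2)
    = (\<Sum>i\<in>I. measure_pmf.variance (p i) (a i))"
proof -
  let ?X = "\<lambda>i x. a i x - expct (p i) (a i)"
  have fin: "finite (set_pmf (Pi_pmf I d p))" using assms by (rule finite_set_Pi_pmf)
  have uncorrelated: "expct (Pi_pmf I d p) (\<lambda>c. ?X i (c i) * ?X j (c j))
      = (if j = i then expct (p i) (\<lambda>x. (?X i x)\<^sup>2) else 0)" if "i \<in> I" "j \<in> I" for i j
  proof (cases "j = i")
    case True
    thus ?thesis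
      using expct_Pi_pmf_component[OF fin_I \<open>i \<in> I\<close>, of d p "\<lambda>x. (?X i x)\<^sup>2"]
      by (simp add: power2_eq_square)
  next
    case False
    thus ?thesis
      using expct_Pi_pmf_pair[OF fin_I that False[symmetric] fin_p, where d = d
        and h = "\<lambda>x y. ?X i x * ?X j y"]
        fin_p[OF that(2)]
      by (simp add: expct_diff)
  qed
  have "expct (Pi_pmf I d p) (\<lambda>c. (\<Sum>i\<in>I. ?X i (c i))\<^sup>2)
      = (\<Sum>i\<in>I. \<Sum>j\<in>I. expct (Pi_pmf I d p) (\<lambda>c. ?X i (c i) * ?X j (c j)))"
    by (simp add: power2_eq_square sum_product expct_sum[OF fin])
  also have "\<dots> = (\<Sum>i\<in>I. expct (p i) (\<lambda>x. (?X i x)\<^sup>2))"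
    by (intro sum.cong refl) (simp add: uncorrelated fin_I cong: sum.cong)
  finally show ?thesis .
qed

lemma expct_abs_sum_deviation_le:
  assumes "finite I" and fin_p: "\<And>i. i \<in> I \<Longrightarrow> finite (set_pmf (p i))"
  shows "expct (Pi_pmf I d p) (\<lambda>c. \<bar>\<Sum>i\<in>I. a i (c i) - expct (p i) (a i)\<bar>)
    \<le> sqrt (\<Sum>i\<in>I. expct (p i) (\<lambda>x. (a i x)\<^sup>2))"
proof -
  have "measure_pmf.variance (p i) (a i) \<le> expct (p i) (\<lambda>x. (a i x)\<^sup>2)" if "i \<in> I" for i
    using fin_p[OF that]
    by (subst measure_pmf.variance_eq) (auto simp: integrable_measure_pmf_finite)
  hence "(\<Sum>i\<in>I. measure_pmf.variance (p i) (a i)) \<le> (\<Sum>i\<in>I. expct (p i) (\<lambda>x. (a i x)\<^sup>2))"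
    by (rule sum_mono)
  hence "expct (Pi_pmf I d p) (\<lambda>c. (\<Sum>i\<in>I. a i (c i) - expct (p i) (a i))\<^sup>2)
      \<le> (\<Sum>i\<in>I. expct (p i) (\<lambda>x. (a i x)\<^sup>2))"
    using variance_sum_Pi_pmf[of I p d a] assms by simp
  hence "sqrt (expct (Pi_pmf I d p) (\<lambda>c. (\<Sum>i\<in>I. a i (c i) - expct (p i) (a i))\<^sup>2))
      \<le> sqrt (\<Sum>i\<in>I. expct (p i) (\<lambda>x. (a i x)\<^sup>2))"
    by (rule real_sqrt_le_mono)
  with expct_abs_le_sqrt[OF finite_set_Pi_pmf[OF assms]] show ?thesis
    by (rule order_trans)
qed

text \<open>Only the part of the summands below the threshold \<open>B\<close> needs a second moment.\<close>

lemma expct_abs_sum_deviation_truncate_le: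
  fixes g :: "'i \<Rightarrow> 'c \<Rightarrow> real"
  assumes fin_I: "finite I" and fin_p: "\<And>i. i \<in> I \<Longrightarrow> finite (set_pmf (p i))"
    and g_nonneg: "\<And>i c. g i c \<ge> 0" and B_nonneg: "B \<ge> 0"
  shows "expct (Pi_pmf I d p) (\<lambda>c. \<bar>(\<Sum>i\<in>I. g i (c i)) - (\<Sum>i\<in>I. expct (p i) (g i))\<bar>)
    \<le> sqrt (B * (\<Sum>i\<in>I. expct (p i) (g i)))
      + 2 * (\<Sum>i\<in>I. expct (p i) (\<lambda>c. g i c * of_bool (B < g i c)))"
proof -
  let ?P = "Pi_pmf I d p"
  have fin: "finite (set_pmf ?P)" using fin_I fin_p by (rule finite_set_Pi_pmf)
  define lo where "lo = (\<lambda>i c. g i c * of_bool (g i c \<le> B))"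
  define hi where "hi = (\<lambda>i c. g i c * of_bool (B < g i c))"
  have g_split: "g i = (\<lambda>c. lo i c + hi i c)" for i
    by (auto simp: lo_def hi_def)
  have lo_bounds: "0 \<le> lo i c" "lo i c \<le> g i c" "lo i c \<le> B" and hi_nonneg: "0 \<le> hi i c" for i c
    using g_nonneg B_nonneg by (auto simp: lo_def hi_def)
  have hi_sum: "0 \<le> (\<Sum>i\<in>I. expct (p i) (hi i))" "0 \<le> (\<Sum>i\<in>I. hi i (c i))" for c
    using hi_nonneg by (auto intro!: sum_nonneg Bochner_Integration.integral_nonneg)
  have mean_split: "(\<Sum>i\<in>I. expct (p i) (g i))
      = (\<Sum>i\<in>I. expct (p i) (lo i)) + (\<Sum>i\<in>I. expct (p i) (hi i))"
    unfolding g_split by (simp add: expct_add[OF fin_p] sum.distrib)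
  have "expct ?P (\<lambda>c. \<bar>(\<Sum>i\<in>I. g i (c i)) - (\<Sum>i\<in>I. expct (p i) (g i))\<bar>)
      \<le> expct ?P (\<lambda>c. \<bar>\<Sum>i\<in>I. lo i (c i) - expct (p i) (lo i)\<bar>
            + (\<Sum>i\<in>I. hi i (c i)) + (\<Sum>i\<in>I. expct (p i) (hi i)))"
  proof (rule expct_mono[OF fin])
    fix c
    have "(\<Sum>i\<in>I. g i (c i)) - (\<Sum>i\<in>I. expct (p i) (g i))
      = (\<Sum>i\<in>I. lo i (c i) - expct (p i) (lo i)) + (\<Sum>i\<in>I. hi i (c i)) - (\<Sum>i\<in>I. expct (p i) (hi i))"
      unfolding mean_split by (simp add: g_split sum.distrib sum_subtractf)
    thus "\<bar>(\<Sum>i\<in>I. g i (c i)) - (\<Sum>i\<in>I. expct (p i) (g i))\<bar> \<le> \<bar>\<Sum>i\<in>I. lo i (c i) - expct (p i) (lo i)\<bar>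
          + (\<Sum>i\<in>I. hi i (c i)) + (\<Sum>i\<in>I. expct (p i) (hi i))"
      using hi_sum(1) hi_sum(2)[of c] by linarith
  qed
  also have "\<dots> = expct ?P (\<lambda>c. \<bar>\<Sum>i\<in>I. lo i (c i) - expct (p i) (lo i)\<bar>)
      + 2 * (\<Sum>i\<in>I. expct (p i) (hi i))"
    by (simp add: expct_add[OF fin] expct_sum[OF fin] expct_Pi_pmf_component[OF fin_I])
  also have "expct ?P (\<lambda>c. \<bar>\<Sum>i\<in>I. lo i (c i) - expct (p i) (lo i)\<bar>)
      \<le> sqrt (\<Sum>i\<in>I. expct (p i) (\<lambda>c. (lo i c)\<^sup>2))"
    by (rule expct_abs_sum_deviation_le[OF fin_I fin_p])
  also have "\<dots> \<le> sqrt (\<Sum>i\<in>I. expct (p i) (\<lambda>c. B * g i c))"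
    unfolding power2_eq_square using lo_bounds B_nonneg
    by (intro real_sqrt_le_mono sum_mono expct_mono fin_p mult_mono)
  finally show ?thesis by (simp add: sum_distrib_left hi_def)
qed

lemma expct_sum_abs_deviation_le:
  fixes g :: "'i \<Rightarrow> 'c \<Rightarrow> 'z \<Rightarrow> real"
  assumes fin_I: "finite I" and fin_p: "\<And>i. i \<in> I \<Longrightarrow> finite (set_pmf (p i))"
    and g_nonneg: "\<And>i c z. 0 \<le> g i c z" and q_nonneg: "\<And>z. 0 \<le> q z" and \<theta>_nonneg: "0 \<le> \<theta>"
    and q_sum: "(\<Sum>z\<in>Z. q z) \<le> 1"
    and mean_sum: "(\<Sum>z\<in>Z. \<Sum>i\<in>I. expct (p i) (\<lambda>c. g i c z)) \<le> 1"
  shows "expct (Pi_pmf I d p)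
      (\<lambda>c. \<Sum>z\<in>Z. \<bar>(\<Sum>i\<in>I. g i (c i) z) - (\<Sum>i\<in>I. expct (p i) (\<lambda>c. g i c z))\<bar>)
    \<le> 2 * (\<Sum>i\<in>I. expct (p i) (\<lambda>c. \<Sum>z\<in>Z. g i c z * of_bool (\<theta> * q z < g i c z))) + sqrt \<theta>"
proof -
  let ?P = "Pi_pmf I d p" and ?mean = "\<lambda>z. \<Sum>i\<in>I. expct (p i) (\<lambda>c. g i c z)"
  let ?tail = "\<lambda>z. \<Sum>i\<in>I. expct (p i) (\<lambda>c. g i c z * of_bool (\<theta> * q z < g i c z))"
  have fin: "finite (set_pmf ?P)" using fin_I fin_p by (rule finite_set_Pi_pmf)
  have mean_nonneg: "0 \<le> ?mean z" for z
    by (intro sum_nonneg Bochner_Integration.integral_nonneg g_nonneg)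
  have "expct ?P (\<lambda>c. \<Sum>z\<in>Z. \<bar>(\<Sum>i\<in>I. g i (c i) z) - ?mean z\<bar>)
      \<le> (\<Sum>z\<in>Z. sqrt (\<theta> * q z * ?mean z) + 2 * ?tail z)"
    unfolding expct_sum[OF fin] using fin_I fin_p g_nonneg q_nonneg \<theta>_nonneg
    by (intro sum_mono expct_abs_sum_deviation_truncate_le) auto
  also have "\<dots> \<le> (\<Sum>z\<in>Z. sqrt \<theta> * ((q z + ?mean z) / 2) + 2 * ?tail z)"
  proof (intro sum_mono add_right_mono)
    fix z
    have "sqrt (\<theta> * q z * ?mean z) = sqrt \<theta> * sqrt (q z * ?mean z)"
      by (simp only: real_sqrt_mult mult.assoc)
    also have "\<dots> \<le> sqrt \<theta> * ((q z + ?mean z) / 2)"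
      using \<theta>_nonneg q_nonneg mean_nonneg by (intro mult_left_mono arith_geo_mean_sqrt) auto
    finally show "sqrt (\<theta> * q z * ?mean z) \<le> sqrt \<theta> * ((q z + ?mean z) / 2)" .
  qed
  also have "\<dots> = sqrt \<theta> * (((\<Sum>z\<in>Z. q z) + (\<Sum>z\<in>Z. ?mean z)) / 2) + 2 * (\<Sum>z\<in>Z. ?tail z)"
    by (simp only: sum.distrib sum_distrib_left[symmetric] sum_divide_distrib[symmetric])
  also have "\<dots> \<le> sqrt \<theta> * 1 + 2 * (\<Sum>z\<in>Z. ?tail z)"
    using q_sum mean_sum \<theta>_nonneg by (intro add_right_mono mult_left_mono) auto
  also have "(\<Sum>z\<in>Z. ?tail z)
      = (\<Sum>i\<in>I. expct (p i) (\<lambda>c. \<Sum>z\<in>Z. g i c z * of_bool (\<theta> * q z < g i c z)))"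
    by (subst sum.swap) (simp add: expct_sum[OF fin_p])
  finally show ?thesis by simp
qed

theorem soft_covering:
  fixes \<rho> :: "'i pmf" and p :: "'i \<Rightarrow> 'c pmf" and k :: "'i \<Rightarrow> 'c \<Rightarrow> 'z pmf"
  assumes fin_\<rho>: "finite (set_pmf \<rho>)" and fin_p: "\<And>i. i \<in> set_pmf \<rho> \<Longrightarrow> finite (set_pmf (p i))"
    and fin_k: "\<And>i c. i \<in> set_pmf \<rho> \<Longrightarrow> c \<in> set_pmf (p i) \<Longrightarrow> finite (set_pmf (k i c))"
    and \<theta>_nonneg: "0 \<le> \<theta>"
  shows "expct (Pi_pmf (set_pmf \<rho>) d p)
      (\<lambda>c. l1_dist (bind_pmf \<rho> (\<lambda>i. k i (c i))) (bind_pmf \<rho> (\<lambda>i. bind_pmf (p i) (k i))))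
    \<le> 2 * expct \<rho> (\<lambda>i. expct (p i) (\<lambda>c.
          prob (k i c) {z. \<theta> * pmf q z < pmf \<rho> i * pmf (k i c) z})) + sqrt \<theta>"
proof -
  let ?I = "set_pmf \<rho>" and ?P = "Pi_pmf (set_pmf \<rho>) d p"
  define Z where "Z = (\<Union>i\<in>?I. \<Union>c\<in>set_pmf (p i). set_pmf (k i c))"
  have fin_Z: "finite Z" using fin_\<rho> fin_p fin_k by (auto simp: Z_def)
  have k_Z: "set_pmf (k i c) \<subseteq> Z" if "i \<in> ?I" "c \<in> set_pmf (p i)" for i c
    using that by (auto simp: Z_def)
  define \<mu> where "\<mu> = bind_pmf \<rho> (\<lambda>i. bind_pmf (p i) (k i))"
  define g where "g = (\<lambda>i c z. pmf \<rho> i * pmf (k i c) z)"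
  have pmf_\<mu>: "(\<Sum>i\<in>?I. expct (p i) (\<lambda>c. g i c z)) = pmf \<mu> z" for z
    by (simp add: \<mu>_def g_def pmf_bind_eq_sum[OF fin_\<rho> order_refl] pmf_bind[of "p _"])
  have "expct ?P (\<lambda>c. l1_dist (bind_pmf \<rho> (\<lambda>i. k i (c i))) \<mu>)
      = expct ?P (\<lambda>c. \<Sum>z\<in>Z. \<bar>(\<Sum>i\<in>?I. g i (c i) z) - (\<Sum>i\<in>?I. expct (p i) (\<lambda>c. g i c z))\<bar>)"
  proof (rule expct_cong)
    fix c assume "c \<in> set_pmf ?P"
    hence "\<And>i. i \<in> ?I \<Longrightarrow> c i \<in> set_pmf (p i)"
      by (auto simp: set_Pi_pmf[OF fin_\<rho>] PiE_dflt_def)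
    hence "set_pmf (bind_pmf \<rho> (\<lambda>i. k i (c i))) \<subseteq> Z" "set_pmf \<mu> \<subseteq> Z"
      using k_Z by (auto simp: \<mu>_def)
    thus "l1_dist (bind_pmf \<rho> (\<lambda>i. k i (c i))) \<mu>
        = (\<Sum>z\<in>Z. \<bar>(\<Sum>i\<in>?I. g i (c i) z) - (\<Sum>i\<in>?I. expct (p i) (\<lambda>c. g i c z))\<bar>)"
      by (simp add: l1_dist_eq_sum[OF fin_Z] pmf_bind_eq_sum[OF fin_\<rho>] pmf_\<mu>) (simp add: g_def)
  qed
  also have "\<dots> \<le> 2 * (\<Sum>i\<in>?I. expct (p i) (\<lambda>c. \<Sum>z\<in>Z. g i c z * of_bool (\<theta> * pmf q z < g i c z)))
      + sqrt \<theta>"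
    using fin_\<rho> fin_p \<theta>_nonneg sum_pmf_le_1[OF fin_Z]
    by (intro expct_sum_abs_deviation_le) (simp_all only: pmf_\<mu>, simp_all add: g_def)
  also have "(\<Sum>i\<in>?I. expct (p i) (\<lambda>c. \<Sum>z\<in>Z. g i c z * of_bool (\<theta> * pmf q z < g i c z)))
      = (\<Sum>i\<in>?I. expct (p i) (\<lambda>c.
          pmf \<rho> i * prob (k i c) {z. \<theta> * pmf q z < pmf \<rho> i * pmf (k i c) z}))"
    by (intro sum.cong refl expct_cong)
      (simp add: g_def prob_eq_sum[OF fin_Z k_Z] sum_distrib_left mult.assoc)
  finally show ?thesis
    by (simp add: \<mu>_def expct_eq_sum[OF fin_\<rho> order_refl])
qed

section \<open>Relative entropy and mutual information\<close>

lemma gibbs_inequality: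
  assumes fin: "finite (set_pmf p)" and sub: "set_pmf p \<subseteq> set_pmf q"
  shows "0 \<le> (\<Sum>a\<in>set_pmf p. pmf p a * ln (pmf p a / pmf q a))"
proof -
  have "0 \<le> (\<Sum>a\<in>set_pmf p. pmf p a - pmf q a)"
    using sum_pmf_le_1[OF fin, of q] fin by (simp add: sum_subtractf sum_pmf_eq_1)
  also have "\<dots> \<le> (\<Sum>a\<in>set_pmf p. pmf p a * ln (pmf p a / pmf q a))"
  proof (rule sum_mono)
    fix a assume "a \<in> set_pmf p"
    hence pos: "0 < pmf p a" "0 < pmf q a" using sub by (auto simp: pmf_positive_iff)
    have "ln (pmf q a / pmf p a) \<le> pmf q a / pmf p a - 1"
      using pos by (intro ln_le_minus_one) auto
    hence "pmf p a * (1 - pmf q a / pmf p a) \<le> pmf p a * ln (pmf p a / pmf q a)"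
      using pos by (intro mult_left_mono) (auto simp: ln_div)
    thus "pmf p a - pmf q a \<le> pmf p a * ln (pmf p a / pmf q a)"
      using pos by (simp add: right_diff_distrib)
  qed
  finally show ?thesis .
qed

lemma KL_div_nonneg:
  assumes "finite (set_pmf P)"
  shows "0 \<le> KL_div P Q"
  using gibbs_inequality[OF assms, of Q] by (auto simp: KL_div_def)

lemma mult_ln_divide_le_abs_diff:
  fixes p q \<mu> :: real
  assumes p_range: "0 < p" "p \<le> 1" and q_range: "0 < \<mu>" "\<mu> \<le> q" "q \<le> 1"
  shows "p * ln (p / q) \<le> (1 + ln (1 / \<mu>)) * \<bar>p - q\<bar>"
proof (cases "q \<le> p")
  case True
  have "p / q \<le> 1 / \<mu>" using p_range q_range by (intro frac_le) auto
  hence "ln (p / q) \<le> ln (1 / \<mu>)" using p_range q_range by simp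
  hence "(p - q) * ln (p / q) \<le> (p - q) * ln (1 / \<mu>)"
    using True by (intro mult_left_mono) auto
  moreover have "q * ln (p / q) \<le> q * (p / q - 1)"
    using p_range q_range by (intro mult_left_mono ln_le_minus_one) auto
  moreover have "q * (p / q - 1) = p - q"
    using q_range by (simp add: field_simps)
  ultimately show ?thesis using True by (simp add: algebra_simps)
next
  case False
  hence "ln (p / q) \<le> 0" using p_range q_range by simp
  hence "p * ln (p / q) \<le> 0" using p_range by (simp add: mult_nonneg_nonpos)
  also have "0 \<le> (1 + ln (1 / \<mu>)) * \<bar>p - q\<bar>" using q_range by simp
  finally show ?thesis .
qed

lemma KL_div_le_l1_dist:
  assumes fin_Q: "finite (set_pmf Q)" and sub: "set_pmf P \<subseteq> set_pmf Q"
    and pmf_lower_bound: "0 < \<mu>" "\<And>a. a \<in> set_pmf Q \<Longrightarrow> \<mu> \<le> pmf Q a"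
  shows "KL_div P Q \<le> ereal ((1 + ln (1 / \<mu>)) * l1_dist P Q)"
proof -
  have fin_P: "finite (set_pmf P)" using sub fin_Q by (rule finite_subset)
  obtain a0 where "a0 \<in> set_pmf Q" using set_pmf_not_empty[of Q] by blast
  hence "\<mu> \<le> 1" using pmf_lower_bound(2)[of a0] pmf_le_1[of Q a0] by linarith
  hence ln_nonneg: "0 \<le> ln (1 / \<mu>)" using pmf_lower_bound(1) by simp
  have "(\<Sum>a\<in>set_pmf P. pmf P a * ln (pmf P a / pmf Q a))
      \<le> (\<Sum>a\<in>set_pmf P. (1 + ln (1 / \<mu>)) * \<bar>pmf P a - pmf Q a\<bar>)"
    using pmf_lower_bound sub
    by (intro sum_mono mult_ln_divide_le_abs_diff) (auto simp: pmf_positive_iff pmf_le_1)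
  also have "\<dots> \<le> (\<Sum>a\<in>set_pmf P \<union> set_pmf Q. (1 + ln (1 / \<mu>)) * \<bar>pmf P a - pmf Q a\<bar>)"
    using fin_Q fin_P ln_nonneg by (intro sum_mono2) auto
  finally show ?thesis
    using sub by (simp add: KL_div_def l1_dist_def sum_distrib_left)
qed

lemma mutual_inf_nonneg:
  assumes "finite (set_pmf p)"
  shows "0 \<le> mutual_inf p F G"
proof -
  let ?pab = "map_pmf (\<lambda>w. (F w, G w)) p" and ?prod = "pair_pmf (map_pmf F p) (map_pmf G p)"
  have "mutual_inf p F G = (\<Sum>x\<in>set_pmf ?pab. pmf ?pab x * ln (pmf ?pab x / pmf ?prod x)) / ln 2"
    by (simp add: mutual_inf_def Let_def case_prod_unfold log_def pmf_pair[symmetric]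
        sum_divide_distrib)
  moreover have "set_pmf ?pab \<subseteq> set_pmf ?prod" by auto
  ultimately show ?thesis
    using gibbs_inequality[of ?pab ?prod] assms by simp
qed

lemma mutual_inf_map_pmf: "mutual_inf p F G = mutual_inf (map_pmf (\<lambda>w. (F w, G w)) p) fst snd"
  by (simp add: mutual_inf_def pmf.map_comp o_def)

lemma mutual_inf_eq_expct:
  assumes "finite (set_pmf p)"
  shows "mutual_inf p F G = expct p (\<lambda>w. log 2 (pmf (map_pmf (\<lambda>w. (F w, G w)) p) (F w, G w)
      / (pmf (map_pmf F p) (F w) * pmf (map_pmf G p) (G w))))"
proof -
  let ?pab = "map_pmf (\<lambda>w. (F w, G w)) p"
  have "mutual_inf p F G
      = expct ?pab (\<lambda>(a, b). log 2 (pmf ?pab (a, b) / (pmf (map_pmf F p) a * pmf (map_pmf G p) b)))"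
    using assms by (subst expct_eq_sum[of "set_pmf ?pab"])
      (auto simp: mutual_inf_def Let_def case_prod_unfold)
  thus ?thesis by simp
qed

lemma cond_mutual_inf_eq_expct:
  assumes "finite (set_pmf p)"
  shows "cond_mutual_inf p F G H
      = expct p (\<lambda>w. log 2 (pmf (map_pmf (\<lambda>w. (F w, G w, H w)) p) (F w, G w, H w)
      * pmf (map_pmf H p) (H w)
      / (pmf (map_pmf (\<lambda>w. (F w, H w)) p) (F w, H w)
        * pmf (map_pmf (\<lambda>w. (G w, H w)) p) (G w, H w))))"
proof -
  let ?pabc = "map_pmf (\<lambda>w. (F w, G w, H w)) p"
  have "cond_mutual_inf p F G H
      = expct ?pabc (\<lambda>(a, b, c). log 2 (pmf ?pabc (a, b, c) * pmf (map_pmf H p) c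
      / (pmf (map_pmf (\<lambda>w. (F w, H w)) p) (a, c) * pmf (map_pmf (\<lambda>w. (G w, H w)) p) (b, c))))"
    using assms by (subst expct_eq_sum[of "set_pmf ?pabc"])
      (auto simp: cond_mutual_inf_def Let_def case_prod_unfold)
  thus ?thesis by simp
qed

lemma pmf_map_pmf_comp_inj: "inj f \<Longrightarrow> pmf (map_pmf (\<lambda>w. f (X w)) p) (f x) = pmf (map_pmf X p) x"
  using pmf_map_inj'[of f "map_pmf X p" x] by (simp add: pmf.map_comp o_def)

lemma mutual_inf_chain:
  assumes fin: "finite (set_pmf p)"
  shows "mutual_inf p (\<lambda>w. (F w, G w)) H = mutual_inf p F H + cond_mutual_inf p G H F"
  unfolding mutual_inf_eq_expct[OF fin] cond_mutual_inf_eq_expct[OF fin]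
    expct_add[OF fin, symmetric]
proof (rule expct_cong)
  fix w assume w_in: "w \<in> set_pmf p"
  let ?pFGH = "pmf (map_pmf (\<lambda>w. ((F w, G w), H w)) p) ((F w, G w), H w)"
  let ?pFG = "pmf (map_pmf (\<lambda>w. (F w, G w)) p) (F w, G w)"
      and ?pFH = "pmf (map_pmf (\<lambda>w. (F w, H w)) p) (F w, H w)"
  let ?pF = "pmf (map_pmf F p) (F w)" and ?pH = "pmf (map_pmf H p) (H w)"
  have joint_GHF: "pmf (map_pmf (\<lambda>w. (G w, H w, F w)) p) (G w, H w, F w) = ?pFGH"
    using pmf_map_pmf_comp_inj[of "\<lambda>((f, g), h). (g, h, f)" "\<lambda>w. ((F w, G w), H w)" p
        "((F w, G w), H w)"]
    by (simp add: inj_on_def)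
  have joint_GF: "pmf (map_pmf (\<lambda>w. (G w, F w)) p) (G w, F w) = ?pFG"
    using pmf_map_pmf_comp_inj[of prod.swap "\<lambda>w. (F w, G w)" p "(F w, G w)"] by simp
  have joint_HF: "pmf (map_pmf (\<lambda>w. (H w, F w)) p) (H w, F w) = ?pFH"
    using pmf_map_pmf_comp_inj[of prod.swap "\<lambda>w. (F w, H w)" p "(F w, H w)"] by simp
  have pos: "0 < ?pFGH" "0 < ?pFG" "0 < ?pFH" "0 < ?pF" "0 < ?pH"
    using w_in by (auto simp: pmf_positive_iff)
  show "log 2 (?pFGH / (?pFG * ?pH)) = log 2 (?pFH / (?pF * ?pH)) +
    log 2 (pmf (map_pmf (\<lambda>w. (G w, H w, F w)) p) (G w, H w, F w) * ?pF /
          (pmf (map_pmf (\<lambda>w. (G w, F w)) p) (G w, F w)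
            * pmf (map_pmf (\<lambda>w. (H w, F w)) p) (H w, F w)))"
    unfolding joint_GHF joint_GF joint_HF using pos by (simp add: log_divide log_mult)
qed

section \<open>Information density\<close>

definition info_density :: "'a pmf \<Rightarrow> ('a \<Rightarrow> 'b pmf) \<Rightarrow> 'a \<times> 'b \<Rightarrow> real" where
  "info_density p k = (\<lambda>(a, b). log 2 (pmf (k a) b / pmf (bind_pmf p k) b))"

definition info_upper_tail :: "'a pmf \<Rightarrow> ('a \<Rightarrow> 'b pmf) \<Rightarrow> real \<Rightarrow> real" where
  "info_upper_tail p k \<tau> = prob (joint_pmf p k) {x. \<tau> < info_density p k x}"

definition info_lower_tail :: "'a pmf \<Rightarrow> ('a \<Rightarrow> 'b pmf) \<Rightarrow> real \<Rightarrow> real" where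
  "info_lower_tail p k \<tau> = prob (joint_pmf p k) {x. info_density p k x \<le> \<tau>}"

lemma pmf_pos_on_joint_pmf:
  assumes "(a, b) \<in> set_pmf (joint_pmf p k)"
  shows "0 < pmf (k a) b" "0 < pmf (bind_pmf p k) b"
  using assms by (auto simp: joint_pmf_def pmf_positive_iff)

definition high_density :: "'a pmf \<Rightarrow> ('a \<Rightarrow> 'b pmf) \<Rightarrow> real \<Rightarrow> 'a \<Rightarrow> 'b set" where
  "high_density p k \<tau> a = {b. 2 powr \<tau> * pmf (bind_pmf p k) b < pmf (k a) b}"

lemma less_info_density_iff:
  assumes "(a, b) \<in> set_pmf (joint_pmf p k)"
  shows "\<tau> < info_density p k (a, b) \<longleftrightarrow> b \<in> high_density p k \<tau> a"
proof -
  have "\<tau> < info_density p k (a, b) \<longleftrightarrow> 2 powr \<tau> < pmf (k a) b / pmf (bind_pmf p k) b"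
    using pmf_pos_on_joint_pmf[OF assms] by (simp add: info_density_def less_log_iff)
  thus ?thesis
    using pmf_pos_on_joint_pmf[OF assms] by (simp add: high_density_def pos_less_divide_eq)
qed

lemma
  assumes "finite (set_pmf p)" "\<And>a. finite (set_pmf (k a))"
  shows info_upper_tail_eq_expct:
    "info_upper_tail p k \<tau> = expct p (\<lambda>a. prob (k a) (high_density p k \<tau> a))"
    and info_lower_tail_eq_expct:
      "info_lower_tail p k \<tau> = expct p (\<lambda>a. prob (k a) (- high_density p k \<tau> a))"
proof -
  have "info_upper_tail p k \<tau> = prob (joint_pmf p k) {(a, b). b \<in> high_density p k \<tau> a}"
    unfolding info_upper_tail_def
    by (rule measure_pmf.finite_measure_eq_AE) (auto simp: AE_measure_pmf_iff less_info_density_iff)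
  thus "info_upper_tail p k \<tau> = expct p (\<lambda>a. prob (k a) (high_density p k \<tau> a))"
    using assms by (simp add: prob_joint_pmf)
  have "info_lower_tail p k \<tau> = prob (joint_pmf p k) {(a, b). b \<notin> high_density p k \<tau> a}"
    unfolding info_lower_tail_def
    by (rule measure_pmf.finite_measure_eq_AE)
      (auto simp: AE_measure_pmf_iff less_info_density_iff[symmetric])
  thus "info_lower_tail p k \<tau> = expct p (\<lambda>a. prob (k a) (- high_density p k \<tau> a))"
    using assms by (simp add: prob_joint_pmf Compl_eq)
qed

lemma prob_high_density_le:
  assumes "finite (set_pmf p)" "\<And>a. finite (set_pmf (k a))"
  shows "prob (bind_pmf p k) (high_density p k \<tau> a) \<le> 2 powr (- \<tau>)"
proof -
  let ?q = "bind_pmf p k"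
  have fin: "finite (set_pmf ?q)" using assms by simp
  have "prob ?q (high_density p k \<tau> a)
      = (\<Sum>b\<in>set_pmf ?q. pmf ?q b * of_bool (b \<in> high_density p k \<tau> a))"
    by (rule prob_eq_sum[OF fin order_refl])
  also have "\<dots> \<le> (\<Sum>b\<in>set_pmf ?q. 2 powr (- \<tau>) * pmf (k a) b)"
    by (intro sum_mono) (auto simp: high_density_def powr_minus field_simps)
  also have "\<dots> \<le> 2 powr (- \<tau>)"
    using sum_pmf_le_1[OF fin, of "k a"] by (simp add: sum_distrib_left[symmetric])
  finally show ?thesis .
qed

definition channel_mutual_inf :: "'a pmf \<Rightarrow> ('a \<Rightarrow> 'b pmf) \<Rightarrow> real" where
  "channel_mutual_inf p k = mutual_inf (joint_pmf p k) fst snd"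

lemma channel_mutual_inf_nonneg:
  assumes "finite (set_pmf p)" "\<And>a. finite (set_pmf (k a))"
  shows "0 \<le> channel_mutual_inf p k"
  unfolding channel_mutual_inf_def using assms by (intro mutual_inf_nonneg finite_set_joint_pmf)

lemma channel_mutual_inf_eq_expct:
  assumes "finite (set_pmf p)" "\<And>a. finite (set_pmf (k a))"
  shows "channel_mutual_inf p k = expct (joint_pmf p k) (info_density p k)"
proof -
  have "finite (set_pmf (joint_pmf p k))"
    using assms by (intro finite_set_joint_pmf)
  thus ?thesis
    unfolding channel_mutual_inf_def
    by (simp add: mutual_inf_eq_expct map_fst_joint_pmf map_snd_joint_pmf)
      (intro expct_cong, auto simp: info_density_def pmf_joint_pmf set_pmf_iff)
qed

section \<open>Derandomized likelihood encoder\<close>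

text \<open>
  The likelihood encoder draws \<open>l\<close> from the conditional law \<open>g x\<close> under the ideal joint law \<open>r\<close>.
  Drawing it once and for all for every source outcome \<open>x\<close> is a random codebook with one codeword
  per \<open>x\<close>, so soft covering controls the effect on the output law.
\<close>

locale likelihood_encoder =
  fixes \<sigma> :: "'x pmf" and r :: "('x \<times> 'l) pmf" and g :: "'x \<Rightarrow> 'l pmf"
  assumes fin_\<sigma>: "finite (set_pmf \<sigma>)" and fin_r: "finite (set_pmf r)"
    and g_range: "\<And>x. set_pmf (g x) \<subseteq> snd ` set_pmf r"
    and r_eq: "joint_pmf (map_pmf fst r) g = r"
begin

lemma fin_g: "finite (set_pmf (g x))"
  using finite_subset[OF g_range] fin_r by blast

lemma fin_joint: "finite (set_pmf (joint_pmf \<sigma> g))"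
  by (rule finite_set_joint_pmf[OF fin_\<sigma> fin_g])

lemma l1_dist_joint_le: "l1_dist (joint_pmf \<sigma> g) r \<le> l1_dist \<sigma> (map_pmf fst r)"
proof -
  have "l1_dist (joint_pmf \<sigma> g) (joint_pmf (map_pmf fst r) g) \<le> l1_dist \<sigma> (map_pmf fst r)"
    unfolding joint_pmf_def using fin_\<sigma> fin_r fin_g by (intro l1_dist_bind_le) auto
  thus ?thesis by (simp only: r_eq)
qed

lemma expct_joint_le:
  assumes "\<And>y. \<bar>h y\<bar> \<le> 1"
  shows "expct (joint_pmf \<sigma> g) h \<le> expct r h + l1_dist \<sigma> (map_pmf fst r)"
  using expct_le_expct_plus_l1_dist[OF fin_joint fin_r, of h, OF assms] l1_dist_joint_le by linarith

lemma expct_random_encoder_cost_le: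
  assumes "\<And>x l. \<bar>h x l\<bar> \<le> 1"
  shows "expct (Pi_pmf (set_pmf \<sigma>) d g) (\<lambda>f. expct \<sigma> (\<lambda>x. h x (f x)))
    \<le> expct r (\<lambda>(x, l). h x l) + l1_dist \<sigma> (map_pmf fst r)"
proof -
  have "expct (Pi_pmf (set_pmf \<sigma>) d g) (\<lambda>f. expct \<sigma> (\<lambda>x. h x (f x)))
      = expct (joint_pmf \<sigma> g) (\<lambda>(x, l). h x l)"
    using fin_\<sigma> fin_g by (simp add: expct_Pi_pmf_expct expct_joint_pmf)
  thus ?thesis using expct_joint_le[of "\<lambda>(x, l). h x l"] assms by (simp add: case_prod_unfold)
qed

lemma expct_random_encoder_output_le:
  fixes w :: "'x \<Rightarrow> 'l \<Rightarrow> 'z pmf" and q :: "'z pmf"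
  assumes fin_w: "\<And>x l. finite (set_pmf (w x l))" and fin_q: "finite (set_pmf q)" and "\<theta> \<ge> 0"
  shows "expct (Pi_pmf (set_pmf \<sigma>) d g) (\<lambda>f. l1_dist (bind_pmf \<sigma> (\<lambda>x. w x (f x))) q)
    \<le> l1_dist (bind_pmf r (\<lambda>(x, l). w x l)) q + 3 * l1_dist \<sigma> (map_pmf fst r)
      + 2 * expct r (\<lambda>(x, l). prob (w x l) {z. \<theta> * pmf q z < pmf \<sigma> x * pmf (w x l) z}) + sqrt \<theta>"
proof -
  let ?F = "Pi_pmf (set_pmf \<sigma>) d g" and ?\<delta> = "l1_dist \<sigma> (map_pmf fst r)"
  let ?w = "\<lambda>(x, l). w x l"
  let ?out = "\<lambda>f. bind_pmf \<sigma> (\<lambda>x. w x (f x))"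
  let ?mean = "bind_pmf (joint_pmf \<sigma> g) ?w"
  let ?tail = "\<lambda>(x, l). prob (w x l) {z. \<theta> * pmf q z < pmf \<sigma> x * pmf (w x l) z}"
  have fin_F: "finite (set_pmf ?F)" using fin_\<sigma> fin_g by (intro finite_set_Pi_pmf) auto
  have fin_out: "finite (set_pmf (?out f))" and fin_mean: "finite (set_pmf ?mean)"
    and fin_ideal: "finite (set_pmf (bind_pmf r ?w))" for f
    using fin_\<sigma> fin_joint fin_r fin_w by auto
  have "?mean = bind_pmf \<sigma> (\<lambda>x. bind_pmf (g x) (w x))"
    by (simp add: bind_joint_pmf)
  hence "expct ?F (\<lambda>f. l1_dist (?out f) ?mean) \<le> 2 * expct (joint_pmf \<sigma> g) ?tail + sqrt \<theta>"
    using soft_covering[OF fin_\<sigma> fin_g fin_w \<open>\<theta> \<ge> 0\<close>, where d = d and q = q] fin_\<sigma> fin_g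
    by (simp add: expct_joint_pmf)
  also have "expct (joint_pmf \<sigma> g) ?tail \<le> expct r ?tail + ?\<delta>"
    by (rule expct_joint_le) auto
  finally have covering: "expct ?F (\<lambda>f. l1_dist (?out f) ?mean)
      \<le> 2 * expct r ?tail + 2 * ?\<delta> + sqrt \<theta>"
    by simp
  have "l1_dist ?mean (bind_pmf r ?w) \<le> l1_dist (joint_pmf \<sigma> g) r"
    using fin_joint fin_r fin_w by (intro l1_dist_bind_le) auto
  hence "l1_dist ?mean q \<le> ?\<delta> + l1_dist (bind_pmf r ?w) q"
    using l1_dist_joint_le l1_dist_triangle[OF fin_mean fin_ideal fin_q] by linarith
  hence "expct ?F (\<lambda>f. l1_dist (?out f) q)
      \<le> expct ?F (\<lambda>f. l1_dist (?out f) ?mean + (?\<delta> + l1_dist (bind_pmf r ?w) q))"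
    by (intro expct_mono[OF fin_F])
      (use l1_dist_triangle[OF fin_out fin_mean fin_q] in \<open>smt (verit)\<close>)
  also have "\<dots> = expct ?F (\<lambda>f. l1_dist (?out f) ?mean) + (?\<delta> + l1_dist (bind_pmf r ?w) q)"
    by (simp add: expct_add[OF fin_F])
  finally show ?thesis using covering by simp
qed

end

theorem ex_derandomized_encoder:
  fixes \<sigma> :: "'x pmf" and r :: "('x \<times> 'l) pmf" and w :: "'x \<Rightarrow> 'l \<Rightarrow> 'z pmf"
  assumes fin: "finite (set_pmf \<sigma>)" "finite (set_pmf r)" "\<And>x l. finite (set_pmf (w x l))"
    "finite (set_pmf q)"
    and h_bounded: "\<And>x l. \<bar>h x l\<bar> \<le> 1" and \<theta>_nonneg: "\<theta> \<ge> 0"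
  shows "\<exists>f. (\<forall>x. f x \<in> snd ` set_pmf r) \<and>
    expct \<sigma> (\<lambda>x. h x (f x)) + l1_dist (bind_pmf \<sigma> (\<lambda>x. w x (f x))) q
    \<le> expct r (\<lambda>(x, l). h x l) + l1_dist (bind_pmf r (\<lambda>(x, l). w x l)) q
      + 4 * l1_dist \<sigma> (map_pmf fst r)
      + 2 * expct r (\<lambda>(x, l). prob (w x l) {z. \<theta> * pmf q z < pmf \<sigma> x * pmf (w x l) z}) + sqrt \<theta>"
proof -
  obtain g where conditional: "\<And>x. set_pmf (g x) \<subseteq> snd ` set_pmf r"
    "joint_pmf (map_pmf fst r) g = r"
    by (rule conditional_kernelE[of r]) (rule that)
  interpret likelihood_encoder \<sigma> r g
    using fin(1,2) conditional by (rule likelihood_encoder.intro)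
  obtain d where d_in: "d \<in> snd ` set_pmf r"
    using set_pmf_not_empty[of r] by auto
  let ?F = "Pi_pmf (set_pmf \<sigma>) d g"
  have fin_F: "finite (set_pmf ?F)" using fin_\<sigma> fin_g by (intro finite_set_Pi_pmf) auto
  let ?obj = "\<lambda>f. expct \<sigma> (\<lambda>x. h x (f x)) + l1_dist (bind_pmf \<sigma> (\<lambda>x. w x (f x))) q"
  obtain f where f_in: "f \<in> set_pmf ?F" and obj_le_mean: "?obj f \<le> expct ?F ?obj"
    using ex_le_expct[OF fin_F, of ?obj] by auto
  have "f x \<in> snd ` set_pmf r" for x
    using f_in d_in conditional(1)
    by (cases "x \<in> set_pmf \<sigma>") (auto simp: set_Pi_pmf[OF fin_\<sigma>] PiE_dflt_def)
  moreover have "expct ?F ?obj = expct ?F (\<lambda>f. expct \<sigma> (\<lambda>x. h x (f x)))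
      + expct ?F (\<lambda>f. l1_dist (bind_pmf \<sigma> (\<lambda>x. w x (f x))) q)"
    by (rule expct_add[OF fin_F])
  ultimately show ?thesis
    using obj_le_mean expct_random_encoder_cost_le[of h d, OF h_bounded]
        expct_random_encoder_output_le[of w q \<theta> d, OF fin(3,4) \<theta>_nonneg]
    by (intro exI[of _ f] conjI allI) (assumption | linarith)+
qed

section \<open>One-shot coding with state information at the encoder\<close>

definition code_cost :: "(nat \<times> 's) pmf \<Rightarrow> ('t \<Rightarrow> 's \<Rightarrow> 'y pmf) \<Rightarrow> ('t \<Rightarrow> 's \<Rightarrow> 'z pmf) \<Rightarrow> 'z pmf
    \<Rightarrow> (nat \<Rightarrow> 's \<Rightarrow> 't) \<Rightarrow> ('y \<Rightarrow> nat) \<Rightarrow> real" where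
  "code_cost \<sigma> wy wz q f D = expct \<sigma> (\<lambda>(m, s). prob (wy (f m s) s) {y. D y \<noteq> m})
     + l1_dist (bind_pmf \<sigma> (\<lambda>(m, s). wz (f m s) s)) q"

lemma code_cost_nonneg: "0 \<le> code_cost \<sigma> wy wz q f D"
  unfolding code_cost_def
  by (intro add_nonneg_nonneg l1_dist_nonneg Bochner_Integration.integral_nonneg) auto

definition marginal_channel :: "('t \<Rightarrow> 's pmf) \<Rightarrow> ('t \<Rightarrow> 's \<Rightarrow> 'y pmf) \<Rightarrow> 't \<Rightarrow> 'y pmf" where
  "marginal_channel k w t = bind_pmf (k t) (w t)"

text \<open>
  A codeword \<open>t\<close> has law \<open>p\<close>; \<open>k t\<close> is the reverse kernel that produces the state from the
  codeword (so \<open>bind_pmf p k\<close> is the law of the true state), and \<open>wy t s\<close>, \<open>wz t s\<close> are the output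
  laws with the input symbol already substituted as a function of \<open>t\<close> and \<open>s\<close>.
\<close>

locale state_code =
  fixes p :: "'t pmf" and k :: "'t \<Rightarrow> 's pmf"
    and wy :: "'t \<Rightarrow> 's \<Rightarrow> 'y pmf" and wz :: "'t \<Rightarrow> 's \<Rightarrow> 'z pmf" and K L :: nat
  assumes fin_p: "finite (set_pmf p)" and fin_k: "\<And>t. finite (set_pmf (k t))"
    and fin_wy: "\<And>t s. finite (set_pmf (wy t s))" and fin_wz: "\<And>t s. finite (set_pmf (wz t s))"
    and K_pos: "K > 0" and L_pos: "L > 0"
begin

abbreviation "ky \<equiv> marginal_channel k wy"
abbreviation "kz \<equiv> marginal_channel k wz"
abbreviation "PS \<equiv> bind_pmf p k"
abbreviation "PY \<equiv> bind_pmf p ky"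
abbreviation "PZ \<equiv> bind_pmf p kz"

definition index_law :: "(nat \<times> nat) pmf" where
  "index_law = pair_pmf (pmf_of_set {..<K}) (pmf_of_set {..<L})"

definition source :: "(nat \<times> 's) pmf" where
  "source = pair_pmf (pmf_of_set {..<K}) PS"

definition codebook :: "(nat \<times> nat \<Rightarrow> 't) pmf" where
  "codebook = Pi_pmf (set_pmf index_law) (SOME t. t \<in> set_pmf p) (\<lambda>_. p)"

text \<open>In the actual experiment the state comes first and the encoder picks \<open>l\<close>; the ideal one
  reverses this.\<close>

definition ideal :: "(nat \<times> nat \<Rightarrow> 't) \<Rightarrow> ((nat \<times> 's) \<times> nat) pmf" where
  "ideal c = bind_pmf index_law (\<lambda>i. map_pmf (\<lambda>s. ((fst i, s), snd i)) (k (c i)))"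

definition decoding_error :: "(nat \<times> nat \<Rightarrow> 't) \<Rightarrow> ('y \<Rightarrow> nat) \<Rightarrow> real" where
  "decoding_error c D = expct index_law (\<lambda>i. prob (ky (c i)) {y. D y \<noteq> fst i})"

definition atypical :: "real \<Rightarrow> 't \<Rightarrow> 's \<Rightarrow> real" where
  "atypical \<theta> t s = prob (wz t s)
     {z. \<theta> * pmf PZ z < pmf PS s / real K * pmf (wz t s) z}"

definition threshold_decoder :: "real \<Rightarrow> (nat \<times> nat \<Rightarrow> 't) \<Rightarrow> 'y \<Rightarrow> nat" where
  "threshold_decoder g c y =
     (SOME m. \<exists>l. (m, l) \<in> set_pmf index_law \<and> y \<in> high_density p ky g (c (m, l)))"

lemma nonempty_ranges: "{..<K} \<noteq> {}" "{..<L} \<noteq> {}"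
  using K_pos L_pos by auto

lemma set_index_law: "set_pmf index_law = {..<K} \<times> {..<L}"
  using nonempty_ranges by (simp add: index_law_def)

lemma fin_index_law: "finite (set_pmf index_law)"
  by (simp add: set_index_law)

lemma pmf_index_law:
  assumes "i \<in> set_pmf index_law"
  shows "pmf index_law i = 1 / (real K * real L)"
  using assms nonempty_ranges by (cases i) (simp add: set_index_law index_law_def pmf_pair)

lemma map_fst_index_law: "map_pmf fst index_law = pmf_of_set {..<K}"
  by (simp add: index_law_def map_fst_pair_pmf)

lemma pmf_source: "m < K \<Longrightarrow> pmf source (m, s) = pmf PS s / real K"
  using nonempty_ranges by (simp add: source_def pmf_pair)

lemma fin_ky: "finite (set_pmf (ky t))" and fin_kz: "finite (set_pmf (kz t))"
  by (simp_all add: marginal_channel_def fin_k fin_wy fin_wz)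

lemma fin_source: "finite (set_pmf source)"
  using nonempty_ranges fin_p fin_k by (simp add: source_def)

lemma fin_ideal: "finite (set_pmf (ideal c))"
  by (simp add: ideal_def fin_index_law fin_k)

lemma fin_codebook: "finite (set_pmf codebook)"
  unfolding codebook_def using fin_index_law fin_p by (intro finite_set_Pi_pmf)

lemma codebook_range:
  assumes "c \<in> set_pmf codebook"
  shows "c i \<in> set_pmf p"
proof -
  have "(SOME t. t \<in> set_pmf p) \<in> set_pmf p" by (simp add: some_in_eq set_pmf_not_empty)
  thus ?thesis
    using assms unfolding codebook_def set_Pi_pmf[OF fin_index_law] PiE_dflt_def
    by (cases "i \<in> set_pmf index_law") (simp_all del: split_paired_All)
qed

lemma expct_codebook_index_law:
  "expct codebook (\<lambda>c. expct index_law (\<lambda>i. h i (c i))) = expct index_law (\<lambda>i. expct p (h i))"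
  unfolding codebook_def using fin_index_law fin_p by (rule expct_Pi_pmf_expct)

lemma expct_ideal:
  "expct (ideal c) h = expct index_law (\<lambda>i. expct (k (c i)) (\<lambda>s. h ((fst i, s), snd i)))"
  unfolding ideal_def using fin_index_law fin_k by (simp add: expct_bind)

lemma expct_index_law_const: "(\<And>i. i \<in> set_pmf index_law \<Longrightarrow> h i = c) \<Longrightarrow> expct index_law h = c"
  by (subst expct_cong[of index_law h "\<lambda>_. c"]) auto

lemma expct_source_deviation_le:
  "expct codebook (\<lambda>c. l1_dist (map_pmf fst (ideal c)) source)
      \<le> 2 * info_upper_tail p k a + sqrt (2 powr a / real L)"
proof -
  let ?w = "\<lambda>i t. map_pmf (Pair (fst i)) (k t)" and ?\<theta> = "2 powr a / real L"
  have "bind_pmf index_law (\<lambda>i. bind_pmf p (?w i))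
      = bind_pmf (map_pmf fst index_law) (\<lambda>m. map_pmf (Pair m) PS)"
    by (simp add: bind_map_pmf map_bind_pmf)
  also have "\<dots> = source"
    by (simp add: map_fst_index_law source_def pair_pmf_def) (simp add: map_pmf_def)
  finally have mean: "bind_pmf index_law (\<lambda>i. bind_pmf p (?w i)) = source" .
  have tail: "prob (?w i t) {x. ?\<theta> * pmf source x < pmf index_law i * pmf (?w i t) x}
      = prob (k t) (high_density p k a t)"
    if i_in: "i \<in> set_pmf index_law" for i t
  proof -
    have "pmf (?w i t) (fst i, s) = pmf (k t) s" for s
      by (rule pmf_map_inj') (simp add: inj_on_def)
    thus ?thesis
      using i_in K_pos L_pos
      by (auto simp: vimage_def high_density_def pmf_index_law pmf_source set_index_law field_simps)
  qed
  have "expct codebook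
      (\<lambda>c. l1_dist (bind_pmf index_law (\<lambda>i. ?w i (c i)))
        (bind_pmf index_law (\<lambda>i. bind_pmf p (?w i))))
      \<le> 2 * expct index_law (\<lambda>i. expct p (\<lambda>t.
          prob (?w i t) {x. ?\<theta> * pmf source x < pmf index_law i * pmf (?w i t) x})) + sqrt ?\<theta>"
    unfolding codebook_def using fin_index_law fin_p fin_k by (intro soft_covering) auto
  also have "expct index_law (\<lambda>i. expct p (\<lambda>t.
          prob (?w i t) {x. ?\<theta> * pmf source x < pmf index_law i * pmf (?w i t) x}))
            = info_upper_tail p k a"
    by (intro expct_index_law_const) (simp only: tail info_upper_tail_eq_expct[OF fin_p fin_k])
  finally show ?thesis
    unfolding mean by (simp add: ideal_def map_bind_pmf pmf.map_comp o_def)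
qed

lemma expct_output_deviation_le:
  "expct codebook (\<lambda>c. l1_dist (bind_pmf index_law (\<lambda>i. kz (c i))) PZ)
    \<le> 2 * info_upper_tail p kz b + sqrt (2 powr b / (real K * real L))"
proof -
  let ?\<theta> = "2 powr b / (real K * real L)"
  have tail: "{z. ?\<theta> * pmf PZ z < pmf index_law i * pmf (kz t) z}
      = high_density p kz b t" if "i \<in> set_pmf index_law" for i t
    using K_pos L_pos by (simp add: high_density_def pmf_index_law[OF that] field_simps)
  have "expct codebook
      (\<lambda>c. l1_dist (bind_pmf index_law (\<lambda>i. kz (c i))) (bind_pmf index_law (\<lambda>i. bind_pmf p kz)))
      \<le> 2 * expct index_law (\<lambda>i. expct p (\<lambda>t.
          prob (kz t) {z. ?\<theta> * pmf PZ z < pmf index_law i * pmf (kz t) z})) + sqrt ?\<theta>"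
    unfolding codebook_def using fin_index_law fin_p fin_kz by (intro soft_covering) auto
  also have "expct index_law (\<lambda>i. expct p (\<lambda>t.
          prob (kz t) {z. ?\<theta> * pmf PZ z < pmf index_law i * pmf (kz t) z}))
            = info_upper_tail p kz b"
    by (intro expct_index_law_const) (simp only: tail info_upper_tail_eq_expct[OF fin_p fin_kz])
  finally show ?thesis by simp
qed

text \<open>Since \<open>k(s|t) wz(z|t,s) \<le> kz(z|t)\<close>, a large product \<open>PS(s) wz(z|t,s)\<close> forces a small
  information density of the state or a large information density of the output.\<close>

lemma expct_atypical_le:
  assumes \<theta>_def: "\<theta> = 2 powr (b - d) / real K"
  shows "expct (k t) (atypical \<theta> t)
    \<le> prob (k t) (- high_density p k d t) + prob (kz t) (high_density p kz b t)"
proof -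
  let ?low = "- high_density p k d t" and ?high = "high_density p kz b t"
  have "atypical \<theta> t s \<le> of_bool (s \<in> ?low) + prob (wz t s) ?high" for s
  proof (cases "s \<in> ?low")
    case True
    thus ?thesis by (simp add: atypical_def add_increasing2)
  next
    case False
    have "z \<in> ?high" if "\<theta> * pmf PZ z < pmf PS s / real K * pmf (wz t s) z" for z
    proof -
      have large_product: "2 powr (b - d) * pmf PZ z < pmf PS s * pmf (wz t s) z"
        using that K_pos by (simp add: \<theta>_def field_simps)
      have "2 powr b * pmf PZ z = 2 powr d * (2 powr (b - d) * pmf PZ z)"
        by (simp add: powr_diff)
      also have "\<dots> < 2 powr d * (pmf PS s * pmf (wz t s) z)"
        using large_product by simp
      also have "\<dots> \<le> pmf (k t) s * pmf (wz t s) z"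
        using False by (simp add: high_density_def mult.assoc[symmetric] mult_right_mono)
      also have "\<dots> \<le> pmf (kz t) z"
        unfolding marginal_channel_def by (rule pmf_mult_le_pmf_bind[OF fin_k])
      finally show ?thesis by (simp add: high_density_def)
    qed
    hence "atypical \<theta> t s \<le> prob (wz t s) ?high"
      unfolding atypical_def by (intro measure_pmf.finite_measure_mono) auto
    thus ?thesis using False by simp
  qed
  hence "expct (k t) (atypical \<theta> t)
      \<le> expct (k t) (\<lambda>s. of_bool (s \<in> ?low) + prob (wz t s) ?high)"
    by (intro expct_mono[OF fin_k])
  also have "\<dots> = prob (k t) ?low + prob (kz t) ?high"
    using fin_k fin_wz
    by (simp only: expct_add prob_eq_expct[of "k t"] marginal_channel_def[of k wz t] prob_bind)
  finally show ?thesis .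
qed

lemma expct_ideal_atypical_le:
  assumes "\<theta> = 2 powr (b - d) / real K"
  shows "expct codebook (\<lambda>c. expct (ideal c) (\<lambda>(x, l). atypical \<theta> (c (fst x, l)) (snd x)))
    \<le> info_lower_tail p k d + info_upper_tail p kz b"
proof -
  have "expct codebook (\<lambda>c. expct (ideal c) (\<lambda>(x, l). atypical \<theta> (c (fst x, l)) (snd x)))
      = expct p (\<lambda>t. expct (k t) (atypical \<theta> t))"
    by (simp add: expct_ideal expct_codebook_index_law[of "\<lambda>i t. expct (k t) (atypical \<theta> t)"])
  also have "\<dots> \<le> expct p (\<lambda>t. prob (k t) (- high_density p k d t)
      + prob (kz t) (high_density p kz b t))"
    by (intro expct_mono fin_p expct_atypical_le assms)
  also have "\<dots> = info_lower_tail p k d + info_upper_tail p kz b"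
    by (simp add: expct_add fin_p fin_k fin_kz info_lower_tail_eq_expct info_upper_tail_eq_expct)
  finally show ?thesis .
qed

lemma expct_false_alarm_le:
  assumes "i \<in> set_pmf index_law" "j \<in> set_pmf index_law" "i \<noteq> j"
  shows "expct codebook (\<lambda>c. prob (ky (c i)) (high_density p ky g (c j))) \<le> 2 powr (- g)"
proof -
  let ?alarm = "\<lambda>t' t. prob (ky t) (high_density p ky g t')"
  have "expct codebook (\<lambda>c. ?alarm (c j) (c i)) = expct p (\<lambda>t'. expct p (?alarm t'))"
    unfolding codebook_def using assms fin_index_law fin_p by (intro expct_Pi_pmf_pair) auto
  also have "\<dots> = expct p (\<lambda>t'. prob PY (high_density p ky g t'))"
    using fin_p fin_ky by (simp add: prob_bind)
  also have "\<dots> \<le> expct p (\<lambda>t'. 2 powr (- g))"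
    by (intro expct_mono prob_high_density_le fin_p fin_ky)
  finally show ?thesis by simp
qed

lemma threshold_decoder_error_subset:
  assumes "i \<in> set_pmf index_law"
  shows "{y. threshold_decoder g c y \<noteq> fst i}
    \<subseteq> - high_density p ky g (c i) \<union> (\<Union>j\<in>set_pmf index_law - {i}. high_density p ky g (c j))"
proof (rule subsetI, rule ccontr)
  let ?passes = "\<lambda>y m l. (m, l) \<in> set_pmf index_law \<and> y \<in> high_density p ky g (c (m, l))"
  fix y assume wrong: "y \<in> {y. threshold_decoder g c y \<noteq> fst i}"
    and unique: "y \<notin> - high_density p ky g (c i)
      \<union> (\<Union>j\<in>set_pmf index_law - {i}. high_density p ky g (c j))"
  have "?passes y (fst i) (snd i)" using unique assms by simp
  hence "\<exists>l. ?passes y (threshold_decoder g c y) l"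
    unfolding threshold_decoder_def by (intro someI[of "\<lambda>m. \<exists>l. ?passes y m l"] exI)
  then obtain l where "?passes y (threshold_decoder g c y) l" by blast
  with unique wrong show False by fastforce
qed

lemma expct_index_error_le:
  assumes i_in: "i \<in> set_pmf index_law"
  shows "expct codebook (\<lambda>c. prob (ky (c i)) {y. threshold_decoder g c y \<noteq> fst i})
    \<le> info_lower_tail p ky g + real K * real L * 2 powr (- g)"
proof -
  let ?others = "set_pmf index_law - {i}"
  let ?miss = "\<lambda>t. - high_density p ky g t" and ?alarm = "high_density p ky g"
  have miss: "expct codebook (\<lambda>c. prob (ky (c i)) (?miss (c i))) = info_lower_tail p ky g"
    unfolding codebook_def info_lower_tail_eq_expct[OF fin_p fin_ky]
    by (rule expct_Pi_pmf_component[OF fin_index_law i_in])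
  have "expct codebook (\<lambda>c. prob (ky (c i)) {y. threshold_decoder g c y \<noteq> fst i})
    \<le> expct codebook (\<lambda>c. prob (ky (c i)) (?miss (c i))
      + (\<Sum>j\<in>?others. prob (ky (c i)) (?alarm (c j))))"
  proof (rule expct_mono[OF fin_codebook])
    fix c
    have "prob (ky (c i)) {y. threshold_decoder g c y \<noteq> fst i}
        \<le> prob (ky (c i)) (?miss (c i) \<union> (\<Union>j\<in>?others. ?alarm (c j)))"
      by (rule measure_pmf.finite_measure_mono[OF threshold_decoder_error_subset[OF i_in]]) simp
    also have "\<dots> \<le> prob (ky (c i)) (?miss (c i)) + prob (ky (c i)) (\<Union>j\<in>?others. ?alarm (c j))"
      by (rule measure_Un_le) auto
    also have "prob (ky (c i)) (\<Union>j\<in>?others. ?alarm (c j))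
        \<le> (\<Sum>j\<in>?others. prob (ky (c i)) (?alarm (c j)))"
      using fin_index_law by (intro measure_UNION_le) auto
    finally show "prob (ky (c i)) {y. threshold_decoder g c y \<noteq> fst i}
        \<le> prob (ky (c i)) (?miss (c i)) + (\<Sum>j\<in>?others. prob (ky (c i)) (?alarm (c j)))"
      by simp
  qed
  also have "\<dots> = info_lower_tail p ky g
      + (\<Sum>j\<in>?others. expct codebook (\<lambda>c. prob (ky (c i)) (?alarm (c j))))"
    by (simp only: expct_add[OF fin_codebook] expct_sum[OF fin_codebook] miss)
  also have "(\<Sum>j\<in>?others. expct codebook (\<lambda>c. prob (ky (c i)) (?alarm (c j))))
      \<le> (\<Sum>j\<in>?others. 2 powr (- g))"
    using i_in by (intro sum_mono expct_false_alarm_le) auto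
  also have "\<dots> \<le> (\<Sum>j\<in>set_pmf index_law. 2 powr (- g))"
    using fin_index_law by (intro sum_mono2) auto
  also have "\<dots> = real K * real L * 2 powr (- g)" by (simp add: set_index_law)
  finally show ?thesis by simp
qed

lemma expct_decoding_error_le:
  "expct codebook (\<lambda>c. decoding_error c (threshold_decoder g c))
    \<le> info_lower_tail p ky g + real K * real L * 2 powr (- g)"
proof -
  have "expct codebook (\<lambda>c. decoding_error c (threshold_decoder g c))
      = expct index_law (\<lambda>i. expct codebook
        (\<lambda>c. prob (ky (c i)) {y. threshold_decoder g c y \<noteq> fst i}))"
    by (simp add: decoding_error_def expct_eq_sum[OF fin_index_law order_refl]
        expct_sum[OF fin_codebook])
  also have "\<dots> \<le> expct index_law (\<lambda>i. info_lower_tail p ky g + real K * real L * 2 powr (- g))"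
    by (intro expct_mono fin_index_law expct_index_error_le)
  finally show ?thesis by simp
qed

lemma ex_encoder_for_codebook:
  assumes c_in: "c \<in> set_pmf codebook" and \<theta>_nonneg: "0 \<le> \<theta>"
  shows "\<exists>f. (\<forall>m s. f m s \<in> set_pmf p) \<and> code_cost source wy wz PZ f D
    \<le> decoding_error c D + l1_dist (bind_pmf index_law (\<lambda>i. kz (c i))) PZ
      + 4 * l1_dist (map_pmf fst (ideal c)) source
      + 2 * expct (ideal c) (\<lambda>(x, l). atypical \<theta> (c (fst x, l)) (snd x)) + sqrt \<theta>"
proof -
  let ?h = "\<lambda>x l. prob (wy (c (fst x, l)) (snd x)) {y. D y \<noteq> fst x}"
  let ?w = "\<lambda>x l. wz (c (fst x, l)) (snd x)"
  obtain f where f_bound: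
    "expct source (\<lambda>x. ?h x (f x)) + l1_dist (bind_pmf source (\<lambda>x. ?w x (f x))) PZ
    \<le> expct (ideal c) (\<lambda>(x, l). ?h x l) + l1_dist (bind_pmf (ideal c) (\<lambda>(x, l). ?w x l)) PZ
      + 4 * l1_dist source (map_pmf fst (ideal c))
      + 2 * expct (ideal c) (\<lambda>(x, l).
          prob (?w x l) {z. \<theta> * pmf PZ z < pmf source x * pmf (?w x l) z})
      + sqrt \<theta>"
    using ex_derandomized_encoder[OF fin_source fin_ideal, of ?w PZ ?h \<theta> c] \<theta>_nonneg
      fin_p fin_wz fin_kz
    by auto
  have "expct (ideal c) (\<lambda>(x, l). ?h x l) = decoding_error c D"
    by (simp add: expct_ideal decoding_error_def marginal_channel_def prob_bind fin_k fin_wy)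
  moreover have "bind_pmf (ideal c) (\<lambda>(x, l). ?w x l) = bind_pmf index_law (\<lambda>i. kz (c i))"
    by (simp add: ideal_def bind_assoc_pmf bind_map_pmf marginal_channel_def[abs_def])
  moreover have "expct (ideal c) (\<lambda>(x, l).
        prob (?w x l) {z. \<theta> * pmf PZ z < pmf source x * pmf (?w x l) z})
      = expct (ideal c) (\<lambda>(x, l). atypical \<theta> (c (fst x, l)) (snd x))"
    by (rule expct_cong) (auto simp: ideal_def set_index_law atypical_def pmf_source)
  ultimately show ?thesis
    using f_bound codebook_range[OF c_in] by (intro exI[of _ "\<lambda>m s. c (m, f (m, s))"])
      (simp add: code_cost_def case_prod_unfold l1_dist_commute)
qed

definition one_shot_bound :: "real \<Rightarrow> real \<Rightarrow> real \<Rightarrow> real \<Rightarrow> real" where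
  "one_shot_bound a b d g = info_lower_tail p ky g + real K * real L * 2 powr (- g)
     + (2 * info_upper_tail p kz b + sqrt (2 powr b / (real K * real L)))
     + 4 * (2 * info_upper_tail p k a + sqrt (2 powr a / real L))
     + 2 * (info_lower_tail p k d + info_upper_tail p kz b) + sqrt (2 powr (b - d) / real K)"

theorem one_shot:
  "\<exists>f D. (\<forall>m s. f m s \<in> set_pmf p) \<and> code_cost source wy wz PZ f D \<le> one_shot_bound a b d g"
proof -
  define \<theta> where "\<theta> = 2 powr (b - d) / real K"
  let ?bound = "\<lambda>c. decoding_error c (threshold_decoder g c)
      + l1_dist (bind_pmf index_law (\<lambda>i. kz (c i))) PZ
      + 4 * l1_dist (map_pmf fst (ideal c)) source
      + 2 * expct (ideal c) (\<lambda>(x, l). atypical \<theta> (c (fst x, l)) (snd x))"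
  obtain c where c_in: "c \<in> set_pmf codebook" and bound_c: "?bound c \<le> expct codebook ?bound"
    using ex_le_expct[OF fin_codebook, of ?bound] by auto
  have "\<theta> \<ge> 0" by (simp add: \<theta>_def)
  from ex_encoder_for_codebook[OF c_in this, of "threshold_decoder g c"] obtain f where
    f_range: "\<forall>m s. f m s \<in> set_pmf p" and
    cost: "code_cost source wy wz PZ f (threshold_decoder g c) \<le> ?bound c + sqrt \<theta>"
    by blast
  have "expct codebook ?bound = expct codebook (\<lambda>c. decoding_error c (threshold_decoder g c))
      + expct codebook (\<lambda>c. l1_dist (bind_pmf index_law (\<lambda>i. kz (c i))) PZ)
      + 4 * expct codebook (\<lambda>c. l1_dist (map_pmf fst (ideal c)) source)
      + 2 * expct codebook (\<lambda>c. expct (ideal c) (\<lambda>(x, l). atypical \<theta> (c (fst x, l)) (snd x)))"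
    by (simp add: expct_add[OF fin_codebook])
  also have "\<dots> \<le> info_lower_tail p ky g + real K * real L * 2 powr (- g)
      + (2 * info_upper_tail p kz b + sqrt (2 powr b / (real K * real L)))
      + 4 * (2 * info_upper_tail p k a + sqrt (2 powr a / real L))
      + 2 * (info_lower_tail p k d + info_upper_tail p kz b)"
    by (intro add_mono mult_left_mono expct_decoding_error_le expct_output_deviation_le
        expct_source_deviation_le expct_ideal_atypical_le \<theta>_def) auto
  finally have "expct codebook ?bound + sqrt \<theta> \<le> one_shot_bound a b d g"
    unfolding one_shot_bound_def \<theta>_def by simp
  thus ?thesis
    using f_range cost bound_c by (intro exI[of _ f] exI[of _ "threshold_decoder g c"]) simp
qed

end

section \<open>Memoryless extensions\<close>

primrec seq_pmf :: "('a \<Rightarrow> 'b pmf) \<Rightarrow> 'a list \<Rightarrow> 'b list pmf" where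
  "seq_pmf k [] = return_pmf []"
| "seq_pmf k (a # as) = bind_pmf (k a) (\<lambda>b. map_pmf (\<lambda>bs. b # bs) (seq_pmf k as))"

definition memoryless :: "('t \<Rightarrow> 's \<Rightarrow> 'y pmf) \<Rightarrow> 't list \<Rightarrow> 's list \<Rightarrow> 'y list pmf" where
  "memoryless w ts ss = seq_pmf (\<lambda>(t, s). w t s) (zip ts ss)"

lemma set_iid_pmf: "set_pmf (iid_pmf n p) = {xs. length xs = n \<and> set xs \<subseteq> set_pmf p}"
proof (induction n)
  case (Suc n)
  show ?case
  proof (intro set_eqI)
    fix xs
    show "xs \<in> set_pmf (iid_pmf (Suc n) p) \<longleftrightarrow> xs \<in> {xs. length xs = Suc n \<and> set xs \<subseteq> set_pmf p}"
      by (cases xs) (auto simp: Suc)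
  qed
qed auto

lemma finite_set_iid_pmf: "finite (set_pmf p) \<Longrightarrow> finite (set_pmf (iid_pmf n p))"
  using finite_lists_length_eq[of "set_pmf p" n] by (simp add: set_iid_pmf conj_commute)

lemma finite_set_seq_pmf: "(\<And>a. finite (set_pmf (k a))) \<Longrightarrow> finite (set_pmf (seq_pmf k as))"
  by (induction as) auto

lemma length_seq_pmf: "bs \<in> set_pmf (seq_pmf k as) \<Longrightarrow> length bs = length as"
  by (induction as arbitrary: bs) auto

lemma pmf_bind_map_Cons:
  "pmf (bind_pmf p (\<lambda>a. map_pmf (\<lambda>as. a # as) q)) (x # xs) = pmf p x * pmf q xs"
proof -
  have "bind_pmf p (\<lambda>a. map_pmf (\<lambda>as. a # as) q) = map_pmf (\<lambda>(a, as). a # as) (pair_pmf p q)"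
    by (simp add: pair_pmf_def map_bind_pmf map_pmf_def bind_assoc_pmf bind_return_pmf)
  also have "pmf \<dots> ((\<lambda>(a, as). a # as) (x, xs)) = pmf (pair_pmf p q) (x, xs)"
    by (rule pmf_map_inj') (auto simp: inj_on_def)
  finally show ?thesis by (simp add: pmf_pair)
qed

lemma map_iid_pmf: "map_pmf (map f) (iid_pmf n p) = iid_pmf n (map_pmf f p)"
proof (induction n)
  case (Suc n)
  have "map_pmf (map f) (iid_pmf (Suc n) p)
      = bind_pmf p (\<lambda>a. map_pmf ((#) (f a)) (map_pmf (map f) (iid_pmf n p)))"
    by (simp add: map_bind_pmf pmf.map_comp o_def)
  thus ?case by (simp add: Suc bind_map_pmf)
qed simp

lemma map_seq_pmf: "map_pmf (map f) (seq_pmf k as) = seq_pmf (\<lambda>a. map_pmf f (k a)) as"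
proof (induction as)
  case (Cons a as)
  have "map_pmf (map f) (seq_pmf k (a # as))
      = bind_pmf (k a) (\<lambda>b. map_pmf ((#) (f b)) (map_pmf (map f) (seq_pmf k as)))"
    by (simp add: map_bind_pmf pmf.map_comp o_def)
  thus ?case by (simp add: Cons bind_map_pmf)
qed simp

lemma seq_pmf_map: "seq_pmf k (map h as) = seq_pmf (\<lambda>a. k (h a)) as"
  by (induction as) simp_all

lemma joint_iid_seq:
  "joint_pmf (iid_pmf n p) (seq_pmf k)
      = map_pmf (\<lambda>l. (map fst l, map snd l)) (iid_pmf n (joint_pmf p k))"
proof (induction n)
  case (Suc n)
  let ?cons = "\<lambda>a b (as, bs). (a # as, b # bs)"
  have "joint_pmf (iid_pmf (Suc n) p) (seq_pmf k)
      = bind_pmf p (\<lambda>a. bind_pmf (iid_pmf n p) (\<lambda>as.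
          bind_pmf (k a) (\<lambda>b. map_pmf (?cons a b) (map_pmf (Pair as) (seq_pmf k as)))))"
    by (simp add: joint_pmf_def bind_assoc_pmf bind_map_pmf map_bind_pmf pmf.map_comp o_def)
  also have "\<dots> = bind_pmf p
      (\<lambda>a. bind_pmf (k a) (\<lambda>b. map_pmf (?cons a b) (joint_pmf (iid_pmf n p) (seq_pmf k))))"
    by (subst bind_commute_pmf) (simp add: joint_pmf_def map_bind_pmf)
  finally show ?case
    unfolding Suc by (simp add: joint_pmf_def bind_assoc_pmf bind_map_pmf map_bind_pmf pmf.map_comp
        o_def)
qed (simp add: joint_pmf_def bind_return_pmf)

lemma bind_iid_seq: "bind_pmf (iid_pmf n p) (seq_pmf k) = iid_pmf n (bind_pmf p k)"
proof -
  have "bind_pmf (iid_pmf n p) (seq_pmf k) = map_pmf snd (joint_pmf (iid_pmf n p) (seq_pmf k))"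
    by (simp add: map_snd_joint_pmf)
  also have "\<dots> = map_pmf (map snd) (iid_pmf n (joint_pmf p k))"
    by (simp add: joint_iid_seq pmf.map_comp o_def)
  finally show ?thesis by (simp add: map_iid_pmf map_snd_joint_pmf)
qed

lemma marginal_channel_memoryless:
  "marginal_channel (seq_pmf k) (memoryless w) = seq_pmf (marginal_channel k w)"
proof
  fix ts
  show "marginal_channel (seq_pmf k) (memoryless w) ts = seq_pmf (marginal_channel k w) ts"
  proof (induction ts)
    case (Cons t ts)
    have "marginal_channel (seq_pmf k) (memoryless w) (t # ts)
      = bind_pmf (k t) (\<lambda>s. bind_pmf (seq_pmf k ts) (\<lambda>ss.
          bind_pmf (w t s) (\<lambda>z. map_pmf ((#) z) (memoryless w ts ss))))"
      by (simp add: marginal_channel_def memoryless_def bind_assoc_pmf bind_map_pmf)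
    also have "\<dots> = bind_pmf (k t) (\<lambda>s. bind_pmf (w t s) (\<lambda>z.
          bind_pmf (seq_pmf k ts) (\<lambda>ss. map_pmf ((#) z) (memoryless w ts ss))))"
      by (subst bind_commute_pmf) simp
    also have "\<dots> = bind_pmf (marginal_channel k w t)
        (\<lambda>z. map_pmf ((#) z) (marginal_channel (seq_pmf k) (memoryless w) ts))"
      by (simp add: marginal_channel_def bind_assoc_pmf map_bind_pmf)
    finally show ?case by (simp add: Cons)
  qed (simp add: marginal_channel_def memoryless_def bind_return_pmf)
qed

lemma info_density_iid_seq:
  assumes "set l \<subseteq> set_pmf (joint_pmf p k)"
  shows "info_density (iid_pmf (length l) p) (seq_pmf k) (map fst l, map snd l)
      = sum_list (map (info_density p k) l)"
proof -
  let ?num = "pmf (seq_pmf k (map fst l)) (map snd l)"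
      and ?den = "pmf (iid_pmf (length l) (bind_pmf p k)) (map snd l)"
  have "0 < ?num \<and> 0 < ?den \<and> log 2 (?num / ?den) = sum_list (map (info_density p k) l)"
    using assms
  proof (induction l)
    case (Cons x l)
    obtain a b where x_eq: "x = (a, b)" by fastforce
    let ?num = "pmf (seq_pmf k (map fst l)) (map snd l)"
    let ?den = "pmf (iid_pmf (length l) (bind_pmf p k)) (map snd l)"
    have pos: "0 < pmf (k a) b" "0 < pmf (bind_pmf p k) b"
      using pmf_pos_on_joint_pmf[of a b p k] Cons.prems x_eq by auto
    have IH: "0 < ?num" "0 < ?den" "log 2 (?num / ?den) = sum_list (map (info_density p k) l)"
      using Cons by auto
    have "log 2 (pmf (k a) b / pmf (bind_pmf p k) b * (?num / ?den))
        = log 2 (pmf (k a) b / pmf (bind_pmf p k) b) + log 2 (?num / ?den)"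
      using pos IH(1,2) by (intro log_mult_pos) auto
    thus ?case
      using pos IH x_eq by (simp add: pmf_bind_map_Cons info_density_def)
  qed simp
  thus ?thesis by (simp add: info_density_def bind_iid_seq)
qed

section \<open>Exponential tails\<close>

definition exponentially_small :: "(nat \<Rightarrow> real) \<Rightarrow> bool" where
  "exponentially_small f \<longleftrightarrow> (\<exists>C \<rho>. 0 \<le> \<rho> \<and> \<rho> < 1 \<and> (\<forall>n. \<bar>f n\<bar> \<le> C * \<rho> ^ n))"

lemma exponentially_smallI:
  "0 \<le> \<rho> \<Longrightarrow> \<rho> < 1 \<Longrightarrow> (\<And>n. \<bar>f n\<bar> \<le> C * \<rho> ^ n) \<Longrightarrow> exponentially_small f"
  by (auto simp: exponentially_small_def)

lemma exponentially_small_mono: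
  assumes "exponentially_small g" "\<And>n. \<bar>f n\<bar> \<le> g n"
  shows "exponentially_small f"
  using assms unfolding exponentially_small_def by (meson abs_ge_self order_trans)

lemma exponentially_small_add:
  assumes "exponentially_small f" "exponentially_small g"
  shows "exponentially_small (\<lambda>n. f n + g n)"
proof -
  obtain C \<rho> where f_bound: "0 \<le> \<rho>" "\<rho> < 1" "\<And>n. \<bar>f n\<bar> \<le> C * \<rho> ^ n"
    using assms(1) by (auto simp: exponentially_small_def)
  obtain D \<sigma> where g_bound: "0 \<le> \<sigma>" "\<sigma> < 1" "\<And>n. \<bar>g n\<bar> \<le> D * \<sigma> ^ n"
    using assms(2) by (auto simp: exponentially_small_def)
  have "\<bar>f n + g n\<bar> \<le> (C + D) * (max \<rho> \<sigma>) ^ n" for n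
  proof -
    have "\<bar>f n + g n\<bar> \<le> C * \<rho> ^ n + D * \<sigma> ^ n"
      using f_bound(3)[of n] g_bound(3)[of n] by linarith
    also have "\<dots> \<le> C * (max \<rho> \<sigma>) ^ n + D * (max \<rho> \<sigma>) ^ n"
      using f_bound(1) g_bound(1) f_bound(3)[of 0] g_bound(3)[of 0]
      by (intro add_mono mult_left_mono power_mono) auto
    finally show ?thesis by (simp add: distrib_right)
  qed
  thus ?thesis using f_bound g_bound by (intro exponentially_smallI[of "max \<rho> \<sigma>"]) auto
qed

lemma exponentially_small_cmult:
  assumes "exponentially_small f"
  shows "exponentially_small (\<lambda>n. c * f n)"
proof -
  obtain C \<rho> where f_bound: "0 \<le> \<rho>" "\<rho> < 1" "\<And>n. \<bar>f n\<bar> \<le> C * \<rho> ^ n"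
    using assms by (auto simp: exponentially_small_def)
  have "\<bar>c * f n\<bar> \<le> (\<bar>c\<bar> * C) * \<rho> ^ n" for n
    using mult_left_mono[OF f_bound(3)[of n], of "\<bar>c\<bar>"] by (simp add: abs_mult mult.assoc)
  thus ?thesis using f_bound by (intro exponentially_smallI[of \<rho>])
qed

lemma exponentially_small_powr:
  assumes "\<delta> > 0"
  shows "exponentially_small (\<lambda>n. 2 powr - (real n * \<delta>))"
proof (rule exponentially_smallI[of "2 powr - \<delta>" _ 1])
  show "\<bar>2 powr - (real n * \<delta>)\<bar> \<le> 1 * (2 powr - \<delta>) ^ n" for n
    by (simp add: powr_realpow[symmetric] powr_powr mult.commute)
  show "2 powr - \<delta> < 1"
    using powr_less_mono[of "- \<delta>" 0 "2 :: real"] assms by simp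
qed simp

lemma exponentially_small_tendsto_0:
  assumes "exponentially_small f"
  shows "f \<longlonglongrightarrow> 0" "(\<lambda>n. real n * f n) \<longlonglongrightarrow> 0"
proof -
  obtain C \<rho> where f_bound: "0 \<le> \<rho>" "\<rho> < 1" "\<And>n. \<bar>f n\<bar> \<le> C * \<rho> ^ n"
    using assms by (auto simp: exponentially_small_def)
  have "(\<lambda>n. C * \<rho> ^ n) \<longlonglongrightarrow> 0"
    using tendsto_mult_right_zero[OF LIMSEQ_realpow_zero[OF f_bound(1,2)]] by simp
  thus "f \<longlonglongrightarrow> 0" by (rule Lim_null_comparison[rotated]) (simp add: f_bound(3))
  have "(\<lambda>n. C * (real n * \<rho> ^ n)) \<longlonglongrightarrow> 0"
    using tendsto_mult_right_zero[OF powser_times_n_limit_0[of \<rho>]] f_bound(1,2) by simp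
  moreover have "\<bar>real n * f n\<bar> \<le> C * (real n * \<rho> ^ n)" for n
    using mult_left_mono[OF f_bound(3)[of n], of "real n"] by (simp add: abs_mult mult.left_commute)
  ultimately show "(\<lambda>n. real n * f n) \<longlonglongrightarrow> 0"
    by (intro Lim_null_comparison[of "\<lambda>n. real n * f n"]) auto
qed

lemma ex_exp_moment_less_1:
  assumes fin: "finite (set_pmf p)" and mean: "expct p a < \<tau>"
  shows "\<exists>u>0. expct p (\<lambda>x. exp (u * (a x - \<tau>))) < 1"
proof -
  define \<phi> where "\<phi> = (\<lambda>u. \<Sum>x\<in>set_pmf p. pmf p x * exp (u * (a x - \<tau>)))"
  have "(\<phi> has_real_derivative (\<Sum>x\<in>set_pmf p. pmf p x * (exp (0 * (a x - \<tau>)) * (a x - \<tau>)))) (at 0)"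
    unfolding \<phi>_def by (intro DERIV_sum DERIV_cmult) (auto intro!: derivative_eq_intros)
  moreover have "(\<Sum>x\<in>set_pmf p. pmf p x * (exp (0 * (a x - \<tau>)) * (a x - \<tau>))) = expct p a - \<tau>"
    using fin by (simp add: expct_eq_sum[OF fin order_refl] right_diff_distrib sum_subtractf
        sum_distrib_right[symmetric] sum_pmf_eq_1)
  ultimately have "(\<phi> has_real_derivative (expct p a - \<tau>)) (at 0)" by simp
  from DERIV_neg_dec_right[OF this] mean obtain d where
    decreasing: "d > 0" "\<And>h. h > 0 \<Longrightarrow> h < d \<Longrightarrow> \<phi> (0 + h) < \<phi> 0"
    by auto
  have "\<phi> (d / 2) < 1"
    using decreasing(1) decreasing(2)[of "d / 2"] fin by (simp add: \<phi>_def sum_pmf_eq_1)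
  thus ?thesis
    using decreasing(1)
    by (intro exI[of _ "d / 2"]) (simp add: \<phi>_def expct_eq_sum[OF fin order_refl])
qed

lemma expct_iid_prod_list:
  assumes "finite (set_pmf p)"
  shows "expct (iid_pmf n p) (\<lambda>xs. prod_list (map e xs)) = expct p e ^ n"
proof (induction n)
  case (Suc n)
  have "expct (iid_pmf (Suc n) p) (\<lambda>xs. prod_list (map e xs))
      = expct p (\<lambda>x. expct (iid_pmf n p) (\<lambda>xs. e x * prod_list (map e xs)))"
    using assms by (simp add: expct_bind finite_set_iid_pmf)
  also have "\<dots> = expct p e * expct p e ^ n"
    by (simp add: Suc)
  finally show ?case by simp
qed simp

lemma chernoff_iid:
  assumes fin: "finite (set_pmf p)" and "expct p a < \<tau>"
  shows "exponentially_small (\<lambda>n. prob (iid_pmf n p) {xs. real n * \<tau> \<le> sum_list (map a xs)})"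
proof -
  obtain u where small_moment: "u > 0" "expct p (\<lambda>x. exp (u * (a x - \<tau>))) < 1"
    using ex_exp_moment_less_1[OF assms] by blast
  let ?e = "\<lambda>x. exp (u * (a x - \<tau>))"
  have prod_eq: "prod_list (map ?e xs)
      = exp (u * (sum_list (map a xs) - real (length xs) * \<tau>))" for xs
    by (induction xs) (simp_all add: exp_add[symmetric] algebra_simps)
  have "prob (iid_pmf n p) {xs. real n * \<tau> \<le> sum_list (map a xs)} \<le> expct p ?e ^ n" for n
  proof -
    have "prob (iid_pmf n p) {xs. real n * \<tau> \<le> sum_list (map a xs)}
        \<le> expct (iid_pmf n p) (\<lambda>xs. prod_list (map ?e xs))"
      unfolding prob_eq_expct prod_eq using small_moment(1)
      by (intro expct_mono finite_set_iid_pmf fin) (auto simp: set_iid_pmf)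
    thus ?thesis by (simp add: expct_iid_prod_list[OF fin])
  qed
  moreover have "0 \<le> expct p ?e" by (intro Bochner_Integration.integral_nonneg) auto
  ultimately show ?thesis using small_moment(2)
    by (intro exponentially_smallI[of "expct p ?e" _ 1]) auto
qed

lemma prob_info_density_iid_seq:
  "prob (joint_pmf (iid_pmf n p) (seq_pmf k)) {x. P (info_density (iid_pmf n p) (seq_pmf k) x)}
    = prob (iid_pmf n (joint_pmf p k)) {l. P (sum_list (map (info_density p k) l))}"
  unfolding joint_iid_seq measure_map_pmf
  by (rule measure_pmf.finite_measure_eq_AE)
    (auto simp: AE_measure_pmf_iff set_iid_pmf info_density_iid_seq)

lemma exponentially_small_info_upper_tail:
  assumes fin: "finite (set_pmf p)" "\<And>a. finite (set_pmf (k a))"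
    and threshold: "channel_mutual_inf p k < \<tau>"
  shows "exponentially_small (\<lambda>n. info_upper_tail (iid_pmf n p) (seq_pmf k) (real n * \<tau>))"
proof (rule exponentially_small_mono)
  show "exponentially_small (\<lambda>n. prob (iid_pmf n (joint_pmf p k))
      {l. real n * \<tau> \<le> sum_list (map (info_density p k) l)})"
    using fin threshold by (intro chernoff_iid finite_set_joint_pmf)
      (simp_all add: channel_mutual_inf_eq_expct)
  show "\<bar>info_upper_tail (iid_pmf n p) (seq_pmf k) (real n * \<tau>)\<bar>
      \<le> prob (iid_pmf n (joint_pmf p k))
        {l. real n * \<tau> \<le> sum_list (map (info_density p k) l)}" for n
    unfolding info_upper_tail_def abs_of_nonneg[OF measure_nonneg]
      prob_info_density_iid_seq[where P = "\<lambda>x. real n * \<tau> < x"]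
    by (rule measure_pmf.finite_measure_mono) auto
qed

lemma exponentially_small_info_lower_tail:
  assumes fin: "finite (set_pmf p)" "\<And>a. finite (set_pmf (k a))"
    and threshold: "\<tau> < channel_mutual_inf p k"
  shows "exponentially_small (\<lambda>n. info_lower_tail (iid_pmf n p) (seq_pmf k) (real n * \<tau>))"
proof (rule exponentially_small_mono)
  show "exponentially_small (\<lambda>n. prob (iid_pmf n (joint_pmf p k))
      {l. real n * - \<tau> \<le> sum_list (map (\<lambda>x. - info_density p k x) l)})"
    using fin threshold by (intro chernoff_iid finite_set_joint_pmf)
      (simp_all add: channel_mutual_inf_eq_expct)
  have neg_sum: "sum_list (map (\<lambda>x. - info_density p k x) l)
      = - sum_list (map (info_density p k) l)" for l
    by (induction l) simp_all
  show "\<bar>info_lower_tail (iid_pmf n p) (seq_pmf k) (real n * \<tau>)\<bar>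
      \<le> prob (iid_pmf n (joint_pmf p k))
        {l. real n * - \<tau> \<le> sum_list (map (\<lambda>x. - info_density p k x) l)}" for n
    unfolding info_lower_tail_def abs_of_nonneg[OF measure_nonneg]
      prob_info_density_iid_seq[where P = "\<lambda>x. x \<le> real n * \<tau>"]
    by (rule measure_pmf.finite_measure_mono) (auto simp: neg_sum)
qed

lemma pmf_iid_ge_power:
  assumes "\<And>x. x \<in> set_pmf q \<Longrightarrow> \<mu> \<le> pmf q x" "0 \<le> \<mu>" "set xs \<subseteq> set_pmf q"
  shows "\<mu> ^ length xs \<le> pmf (iid_pmf (length xs) q) xs"
  using assms(3)
proof (induction xs)
  case (Cons x xs)
  thus ?case using assms(1)[of x] assms(2) by (simp add: pmf_bind_map_Cons mult_mono)
qed simp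

lemma KL_div_iid_tendsto_0:
  assumes fin: "finite (set_pmf Q)" and sub: "\<And>n. set_pmf (P n) \<subseteq> set_pmf (iid_pmf n Q)"
    and small: "exponentially_small (\<lambda>n. l1_dist (P n) (iid_pmf n Q))"
  shows "(\<lambda>n. KL_div (P n) (iid_pmf n Q)) \<longlonglongrightarrow> 0"
proof -
  let ?d = "\<lambda>n. l1_dist (P n) (iid_pmf n Q)"
  define \<mu> where "\<mu> = Min (pmf Q ` set_pmf Q)"
  have \<mu>_le: "\<mu> \<le> pmf Q x" if "x \<in> set_pmf Q" for x
    using fin that by (simp add: \<mu>_def)
  have \<mu>_pos: "0 < \<mu>"
    using fin by (auto simp: \<mu>_def set_pmf_not_empty pmf_positive_iff)
  have upper: "KL_div (P n) (iid_pmf n Q) \<le> ereal (?d n + ln (1 / \<mu>) * (real n * ?d n))" for n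
  proof -
    have "KL_div (P n) (iid_pmf n Q) \<le> ereal ((1 + ln (1 / \<mu> ^ n)) * ?d n)"
      using finite_set_iid_pmf[OF fin, of n] sub \<mu>_le \<mu>_pos pmf_iid_ge_power[of Q \<mu>]
      by (intro KL_div_le_l1_dist) (auto simp: set_iid_pmf)
    also have "(1 + ln (1 / \<mu> ^ n)) * ?d n = ?d n + ln (1 / \<mu>) * (real n * ?d n)"
      using \<mu>_pos by (simp add: ln_div ln_realpow algebra_simps)
    finally show ?thesis .
  qed
  have "finite (set_pmf (P n))" for n
    using sub finite_set_iid_pmf[OF fin] by (rule finite_subset)
  hence lower: "0 \<le> KL_div (P n) (iid_pmf n Q)" for n
    by (rule KL_div_nonneg)
  have "(\<lambda>n. ?d n + ln (1 / \<mu>) * (real n * ?d n)) \<longlonglongrightarrow> 0 + ln (1 / \<mu>) * 0"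
    using exponentially_small_tendsto_0[OF small] by (intro tendsto_intros)
  hence "(\<lambda>n. ereal (?d n + ln (1 / \<mu>) * (real n * ?d n))) \<longlonglongrightarrow> 0"
    by (simp add: zero_ereal_def)
  thus ?thesis
    by (rule tendsto_sandwich[OF _ _ tendsto_const, rotated 2]) (auto simp: lower upper)
qed

section \<open>Block codes\<close>

lemma num_msgs_ge: "2 powr (real n * R) \<le> real (num_msgs n R)"
  unfolding num_msgs_def by linarith

lemma num_msgs_pos: "num_msgs n R > 0"
proof -
  have "0 < real (num_msgs n R)" using num_msgs_ge[of n R] by (rule less_le_trans[rotated]) simp
  thus ?thesis by simp
qed

lemma num_msgs_le:
  assumes "R \<ge> 0"
  shows "real (num_msgs n R) \<le> 2 * 2 powr (real n * R)"
proof -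
  have "1 \<le> 2 powr (real n * R)" using assms by (simp add: ge_one_powr_ge_zero)
  thus ?thesis unfolding num_msgs_def by linarith
qed

lemma powr_divide_num_msgs_le:
  assumes "x + \<delta> \<le> R"
  shows "2 powr (real n * x) / real (num_msgs n R) \<le> 2 powr - (real n * \<delta>)"
proof -
  have "real n * x \<le> - (real n * \<delta>) + real n * R"
    using mult_left_mono[OF assms, of "real n"] by (simp add: distrib_left)
  hence "2 powr (real n * x) \<le> 2 powr (- (real n * \<delta>) + real n * R)" by simp
  also have "\<dots> = 2 powr - (real n * \<delta>) * 2 powr (real n * R)" by (rule powr_add)
  also have "\<dots> \<le> 2 powr - (real n * \<delta>) * real (num_msgs n R)"
    by (intro mult_left_mono num_msgs_ge) simp
  finally show ?thesis using num_msgs_pos[of n R] by (simp add: divide_le_eq)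
qed

lemma powr_divide_num_msgs_mult_le:
  assumes "x + \<delta> \<le> R + R'"
  shows "2 powr (real n * x) / (real (num_msgs n R) * real (num_msgs n R')) \<le> 2 powr - (real n * \<delta>)"
proof -
  have "2 powr (real n * x) / real (num_msgs n R) \<le> 2 powr (real n * (x - R))"
    using powr_divide_num_msgs_le[of x "R - x" R n] by (simp add: right_diff_distrib)
  hence "2 powr (real n * x) / real (num_msgs n R) / real (num_msgs n R')
      \<le> 2 powr (real n * (x - R)) / real (num_msgs n R')"
    by (rule divide_right_mono) simp
  also have "\<dots> \<le> 2 powr - (real n * \<delta>)"
    using assms by (intro powr_divide_num_msgs_le) simp
  finally show ?thesis by simp
qed

lemma num_msgs_mult_powr_le:
  assumes "R \<ge> 0" "R' \<ge> 0" "R + R' + \<delta> \<le> g"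
  shows "real (num_msgs n R) * real (num_msgs n R') * 2 powr - (real n * g)
      \<le> 4 * 2 powr - (real n * \<delta>)"
proof -
  have "real (num_msgs n R) * real (num_msgs n R') * 2 powr - (real n * g)
      \<le> (2 * 2 powr (real n * R)) * (2 * 2 powr (real n * R')) * 2 powr - (real n * g)"
    using assms(1,2) by (intro mult_right_mono mult_mono num_msgs_le) auto
  also have "\<dots> = 4 * 2 powr (real n * R + real n * R' + - (real n * g))"
    by (simp only: powr_add)
  also have "\<dots> \<le> 4 * 2 powr - (real n * \<delta>)"
    using mult_left_mono[OF assms(3), of "real n"] by (simp add: distrib_left)
  finally show ?thesis .
qed

lemma sqrt_le_powr_half:
  assumes "x \<le> 2 powr y"
  shows "sqrt x \<le> 2 powr (y / 2)"
proof -
  have "sqrt x \<le> sqrt (2 powr y)" using assms by (rule real_sqrt_le_mono)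
  also have "\<dots> = 2 powr (y / 2)"
    by (rule real_sqrt_unique) (simp_all add: power2_eq_square powr_add[symmetric])
  finally show ?thesis .
qed

lemma ex_block_code:
  fixes n :: nat
  assumes fin: "finite (set_pmf p)" "\<And>t. finite (set_pmf (k t))"
      "\<And>t s. finite (set_pmf (wy t s))" "\<And>t s. finite (set_pmf (wz t s))"
    and rates: "0 \<le> R" "0 \<le> R'" "0 \<le> \<delta>"
    and thresholds: "a + \<delta> \<le> R'" "b + \<delta> \<le> R + R'" "R + R' + \<delta> \<le> g" "b - d + \<delta> \<le> R"
  defines "source \<equiv> pair_pmf (pmf_of_set {..<num_msgs n R}) (iid_pmf n (bind_pmf p k))"
    and "kY \<equiv> marginal_channel k wy" and "kZ \<equiv> marginal_channel k wz"
  shows "\<exists>f D. (\<forall>m s. length (f m s) = n) \<and>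
    code_cost source (memoryless wy) (memoryless wz) (iid_pmf n (bind_pmf p kZ)) f D
    \<le> info_lower_tail (iid_pmf n p) (seq_pmf kY) (real n * g)
      + 4 * info_upper_tail (iid_pmf n p) (seq_pmf kZ) (real n * b)
      + 8 * info_upper_tail (iid_pmf n p) (seq_pmf k) (real n * a)
      + 2 * info_lower_tail (iid_pmf n p) (seq_pmf k) (real n * d)
      + 10 * 2 powr - (real n * (\<delta> / 2))"
proof -
  let ?K = "num_msgs n R" and ?L = "num_msgs n R'"
  interpret block: state_code "iid_pmf n p" "seq_pmf k" "memoryless wy" "memoryless wz" ?K ?L
    using fin by unfold_locales
      (auto simp: memoryless_def num_msgs_pos intro!: finite_set_iid_pmf finite_set_seq_pmf)
  have block_source: "block.source = source"
    by (simp add: block.source_def source_def bind_iid_seq)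
  obtain f D where "\<forall>m s. f m s \<in> set_pmf (iid_pmf n p)"
    and cost: "code_cost source (memoryless wy) (memoryless wz) (iid_pmf n (bind_pmf p kZ)) f D
      \<le> block.one_shot_bound (real n * a) (real n * b) (real n * d) (real n * g)"
    using block.one_shot[of "real n * a" "real n * b" "real n * d" "real n * g"]
    unfolding block_source marginal_channel_memoryless bind_iid_seq kZ_def by blast
  hence lengths: "\<forall>m s. length (f m s) = n" by (simp add: set_iid_pmf)
  have "real ?K * real ?L * 2 powr - (real n * g) \<le> 4 * 2 powr - (real n * \<delta>)"
    using rates thresholds by (intro num_msgs_mult_powr_le)
  also have "\<dots> \<le> 4 * 2 powr - (real n * (\<delta> / 2))"
    using rates(3) by simp
  finally have packing: "real ?K * real ?L * 2 powr - (real n * g)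
      \<le> 4 * 2 powr - (real n * (\<delta> / 2))" .
  have covering: "sqrt (2 powr (real n * b) / (real ?K * real ?L)) \<le> 2 powr - (real n * (\<delta> / 2))"
      "sqrt (2 powr (real n * a) / real ?L) \<le> 2 powr - (real n * (\<delta> / 2))"
      "sqrt (2 powr (real n * b - real n * d) / real ?K) \<le> 2 powr - (real n * (\<delta> / 2))"
    using thresholds powr_divide_num_msgs_le[of "b - d" \<delta> R n]
      sqrt_le_powr_half[of _ "- (real n * \<delta>)"]
    by (auto intro!: powr_divide_num_msgs_mult_le powr_divide_num_msgs_le simp: right_diff_distrib)
  show ?thesis
    using lengths packing covering
      cost[unfolded block.one_shot_bound_def marginal_channel_memoryless, folded kY_def kZ_def]
    by (intro exI[of _ f] exI[of _ D] conjI) (assumption, argo)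
qed

theorem ex_block_codes:
  fixes p :: "'t pmf" and k :: "'t \<Rightarrow> 's pmf" and wy :: "'t \<Rightarrow> 's \<Rightarrow> 'y pmf"
    and wz :: "'t \<Rightarrow> 's \<Rightarrow> 'z pmf"
  assumes fin: "finite (set_pmf p)" "\<And>t. finite (set_pmf (k t))"
      "\<And>t s. finite (set_pmf (wy t s))" "\<And>t s. finite (set_pmf (wz t s))"
    and rate: "0 \<le> R" "channel_mutual_inf p (marginal_channel k wz) - channel_mutual_inf p k < R"
      "R < channel_mutual_inf p (marginal_channel k wy) - channel_mutual_inf p k"
  defines "source \<equiv> \<lambda>n. pair_pmf (pmf_of_set {..<num_msgs n R}) (iid_pmf n (bind_pmf p k))"
  shows "\<exists>f D. (\<forall>n m s. length (f n m s) = n) \<and>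
    exponentially_small (\<lambda>n. code_cost (source n) (memoryless wy) (memoryless wz)
      (iid_pmf n (bind_pmf p (marginal_channel k wz))) (f n) (D n))"
proof -
  let ?ky = "marginal_channel k wy" and ?kz = "marginal_channel k wz"
  define IS IY IZ where "IS = channel_mutual_inf p k" "IY = channel_mutual_inf p ?ky"
    "IZ = channel_mutual_inf p ?kz"
  note I_defs = this
  define \<delta> where "\<delta> = min ((IY - IS - R) / 4) ((R + IS - IZ) / 3)"
  have "\<delta> \<le> (IY - IS - R) / 4" "\<delta> \<le> (R + IS - IZ) / 3"
    unfolding \<delta>_def by (rule min.cobounded1, rule min.cobounded2)
  moreover have "\<delta> > 0"
    using rate by (simp add: \<delta>_def I_defs)
  ultimately have \<delta>_bounds: "\<delta> > 0" "4 * \<delta> \<le> IY - IS - R" "3 * \<delta> \<le> R + IS - IZ" by auto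
  have "IS \<ge> 0"
    unfolding I_defs using fin by (intro channel_mutual_inf_nonneg)
  define bound where "bound = (\<lambda>n. info_lower_tail (iid_pmf n p) (seq_pmf ?ky) (real n * (IY - \<delta>))
      + 4 * info_upper_tail (iid_pmf n p) (seq_pmf ?kz) (real n * (IZ + \<delta>))
      + 8 * info_upper_tail (iid_pmf n p) (seq_pmf k) (real n * (IS + \<delta>))
      + 2 * info_lower_tail (iid_pmf n p) (seq_pmf k) (real n * (IS - \<delta>))
        + 10 * 2 powr - (real n * (\<delta> / 2)))"
  have "exponentially_small bound"
    unfolding bound_def using fin \<delta>_bounds(1)
    by (intro exponentially_small_add exponentially_small_cmult exponentially_small_powr
        exponentially_small_info_lower_tail exponentially_small_info_upper_tail)
      (auto simp: I_defs marginal_channel_def)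
  let ?cost = "\<lambda>n. code_cost (source n) (memoryless wy) (memoryless wz)
      (iid_pmf n (bind_pmf p ?kz))"
  have "\<exists>f D. (\<forall>m s. length (f m s) = n) \<and> ?cost n f D \<le> bound n" for n
    unfolding bound_def source_def using rate(1) \<delta>_bounds \<open>IS \<ge> 0\<close>
    by (intro ex_block_code[where R' = "IS + 2 * \<delta>"] fin) auto
  then obtain f D where lengths: "\<And>n m s. length (f n m s) = n"
      and cost_le: "\<And>n. ?cost n (f n) (D n) \<le> bound n"
    by metis
  have "exponentially_small (\<lambda>n. ?cost n (f n) (D n))"
    by (rule exponentially_small_mono[OF \<open>exponentially_small bound\<close>])
      (simp add: cost_le code_cost_nonneg)
  with lengths show ?thesis by blast
qed

section \<open>Codes for the state-dependent channel\<close>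

abbreviation receiver_channel :: "('x \<Rightarrow> 's \<Rightarrow> ('y \<times> 'z) pmf) \<Rightarrow> 'x \<Rightarrow> 's \<Rightarrow> 'y pmf" where
  "receiver_channel W \<equiv> \<lambda>x s. map_pmf fst (W x s)"

abbreviation warden_channel :: "('x \<Rightarrow> 's \<Rightarrow> ('y \<times> 'z) pmf) \<Rightarrow> 'x \<Rightarrow> 's \<Rightarrow> 'z pmf" where
  "warden_channel W \<equiv> \<lambda>x s. map_pmf snd (W x s)"

lemma chan_seq_eq_memoryless:
  "chan_seq W xs ss = map_pmf (\<lambda>l. (map fst l, map snd l)) (memoryless W xs ss)"
proof (induction xs arbitrary: ss)
  case (Cons x xs)
  thus ?case
    by (cases ss) (simp_all add: memoryless_def map_bind_pmf pmf.map_comp o_def case_prod_unfold)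
qed (simp add: memoryless_def)

lemma map_pmf_memoryless:
  "map_pmf (map f) (memoryless w xs ss) = memoryless (\<lambda>x s. map_pmf f (w x s)) xs ss"
  by (simp add: memoryless_def map_seq_pmf case_prod_unfold)

lemma map_fst_chan_seq: "map_pmf fst (chan_seq W xs ss) = memoryless (receiver_channel W) xs ss"
  and map_snd_chan_seq: "map_pmf snd (chan_seq W xs ss) = memoryless (warden_channel W) xs ss"
  by (simp_all add: chan_seq_eq_memoryless pmf.map_comp o_def map_pmf_memoryless)

lemma memoryless_map2: "memoryless w (map2 x ts ss) ss = memoryless (\<lambda>t s. w (x t s) s) ts ss"
proof (induction ts arbitrary: ss)
  case (Cons t ts)
  thus ?case by (cases ss) (auto simp: memoryless_def)
qed (simp add: memoryless_def)

lemma finite_set_memoryless: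
  "(\<And>x s. finite (set_pmf (w x s))) \<Longrightarrow> finite (set_pmf (memoryless w xs ss))"
  unfolding memoryless_def by (intro finite_set_seq_pmf) auto

lemma length_memoryless:
  "ys \<in> set_pmf (memoryless w xs ss) \<Longrightarrow> length ys = min (length xs) (length ss)"
  unfolding memoryless_def by (auto dest: length_seq_pmf)

lemma nct_code_dist_eq:
  "nct_code_dist n K QS W enc = bind_pmf (pair_pmf (pmf_of_set {..<K}) (iid_pmf n QS))
     (\<lambda>(m, s). map_pmf (\<lambda>(y, z). (m, y, z)) (chan_seq W (enc m s) s))"
  by (simp add: nct_code_dist_def pair_pmf_def bind_assoc_pmf bind_return_pmf)

lemma nct_warden_dist_eq:
  "nct_warden_dist n K QS W enc = bind_pmf (pair_pmf (pmf_of_set {..<K}) (iid_pmf n QS))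
     (\<lambda>(m, s). memoryless (warden_channel W) (enc m s) s)"
  unfolding nct_warden_dist_def nct_code_dist_eq map_snd_chan_seq[symmetric]
  by (simp add: map_bind_pmf pmf.map_comp o_def case_prod_unfold)

lemma nct_error_prob_eq:
  fixes W :: "'x \<Rightarrow> 's \<Rightarrow> ('y::finite \<times> 'z::finite) pmf"
  assumes "K > 0" "finite (set_pmf QS)"
  shows "nct_error_prob n K QS W enc dec = expct (pair_pmf (pmf_of_set {..<K}) (iid_pmf n QS))
     (\<lambda>(m, s). prob (memoryless (receiver_channel W) (enc m s) s) {y. dec y \<noteq> m})"
proof -
  have "finite (set_pmf (pair_pmf (pmf_of_set {..<K}) (iid_pmf n QS)))"
    using assms by (simp add: finite_set_iid_pmf lessThan_empty_iff)
  hence "nct_error_prob n K QS W enc dec = expct (pair_pmf (pmf_of_set {..<K}) (iid_pmf n QS))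
     (\<lambda>(m, s). prob (map_pmf (\<lambda>(y, z). (m, y, z)) (chan_seq W (enc m s) s)) {(m, y, z). dec y \<noteq> m})"
    unfolding nct_error_prob_def nct_code_dist_eq
    by (subst prob_bind) (auto simp: chan_seq_eq_memoryless finite_set_memoryless case_prod_unfold)
  also have "\<dots> = expct (pair_pmf (pmf_of_set {..<K}) (iid_pmf n QS))
     (\<lambda>(m, s). prob (map_pmf fst (chan_seq W (enc m s) s)) {y. dec y \<noteq> m})"
    by (simp add: vimage_def case_prod_unfold)
  finally show ?thesis unfolding map_fst_chan_seq .
qed

lemma covert_achievable_NCTI:
  fixes QS :: "'s pmf" and W :: "'x \<Rightarrow> 's \<Rightarrow> ('y::finite \<times> 'z::finite) pmf"
  assumes full: "set_pmf (innocent_out QS W x0) = UNIV" and fin: "finite (set_pmf QS)"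
    and lengths: "\<And>n m s. length s = n \<Longrightarrow> length (enc n m s) = n"
    and small: "exponentially_small (\<lambda>n.
        code_cost (pair_pmf (pmf_of_set {..<num_msgs n R}) (iid_pmf n QS))
          (memoryless (receiver_channel W)) (memoryless (warden_channel W))
          (iid_pmf n (innocent_out QS W x0)) (enc n) (dec n))"
  shows "covert_achievable_NCT QS W x0 R"
proof -
  let ?err = "\<lambda>n. nct_error_prob n (num_msgs n R) QS W (enc n) (dec n)"
  let ?warden = "\<lambda>n. nct_warden_dist n (num_msgs n R) QS W (enc n)"
  let ?Q = "innocent_out QS W x0"
  have cost: "exponentially_small (\<lambda>n. ?err n + l1_dist (?warden n) (iid_pmf n ?Q))"
    using small
    by (simp add: code_cost_def nct_error_prob_eq[OF num_msgs_pos fin] nct_warden_dist_eq)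
  have nonneg: "0 \<le> ?err n" "0 \<le> l1_dist (?warden n) (iid_pmf n ?Q)" for n
    by (simp_all add: nct_error_prob_def l1_dist_nonneg)
  have "exponentially_small ?err"
    by (rule exponentially_small_mono[OF cost]) (simp add: nonneg)
  moreover have "exponentially_small (\<lambda>n. l1_dist (?warden n) (iid_pmf n ?Q))"
    by (rule exponentially_small_mono[OF cost]) (simp add: nonneg)
  moreover have "set_pmf (?warden n) \<subseteq> set_pmf (iid_pmf n ?Q)" for n
    using full by (auto simp: nct_warden_dist_eq set_iid_pmf lengths dest: length_memoryless)
  ultimately have "?err \<longlonglongrightarrow> 0" "(\<lambda>n. KL_div (?warden n) (iid_pmf n ?Q)) \<longlonglongrightarrow> 0"
    using KL_div_iid_tendsto_0[of ?Q ?warden] by (simp_all add: exponentially_small_tendsto_0)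
  thus ?thesis
    unfolding covert_achievable_NCT_def using lengths by blast
qed

lemma covert_achievable_zero:
  fixes QS :: "'s pmf" and W :: "'x \<Rightarrow> 's \<Rightarrow> ('y::finite \<times> 'z::finite) pmf"
  assumes full: "set_pmf (innocent_out QS W x0) = UNIV" and fin: "finite (set_pmf QS)"
  shows "covert_achievable_NCT QS W x0 0"
proof (rule covert_achievable_NCTI[OF full fin,
      where enc = "\<lambda>n m s. replicate n x0" and dec = "\<lambda>n y. 0"])
  let ?source = "\<lambda>n. pair_pmf (pmf_of_set {..<num_msgs n 0}) (iid_pmf n QS)"
  have one_msg: "pmf_of_set {..<num_msgs n 0} = return_pmf 0" for n
    by (simp add: num_msgs_def lessThan_Suc pmf_of_set_singleton)
  have "expct (?source n)
      (\<lambda>(m, s). prob (memoryless (receiver_channel W) (replicate n x0) s) {y. 0 \<noteq> m}) = 0" for n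
    by (subst expct_cong[where g = "\<lambda>_. 0"]) (auto simp: one_msg)
  moreover have "bind_pmf (?source n) (\<lambda>(m, s). memoryless (warden_channel W) (replicate n x0) s)
      = iid_pmf n (innocent_out QS W x0)" for n
  proof -
    have "bind_pmf (?source n) (\<lambda>(m, s). memoryless (warden_channel W) (replicate n x0) s)
        = bind_pmf (iid_pmf n QS) (memoryless (warden_channel W) (replicate n x0))"
      by (simp add: one_msg pair_pmf_def bind_assoc_pmf bind_return_pmf)
    also have "\<dots> = bind_pmf (iid_pmf n QS) (seq_pmf (warden_channel W x0))"
      by (intro bind_pmf_cong refl)
        (auto simp: memoryless_def set_iid_pmf zip_replicate1 seq_pmf_map)
    finally show ?thesis by (simp add: bind_iid_seq innocent_out_def)
  qed
  ultimately have "code_cost (?source n) (memoryless (receiver_channel W))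
      (memoryless (warden_channel W))
      (iid_pmf n (innocent_out QS W x0)) (\<lambda>m s. replicate n x0) (\<lambda>y. 0) = 0" for n
    by (simp only: code_cost_def) (simp add: l1_dist_def)
  thus "exponentially_small (\<lambda>n. code_cost (?source n) (memoryless (receiver_channel W))
      (memoryless (warden_channel W)) (iid_pmf n (innocent_out QS W x0))
      (\<lambda>m s. replicate n x0) (\<lambda>y. 0))"
    by (intro exponentially_smallI[of 0 _ 0]) auto
qed auto

section \<open>Achievability\<close>

lemma le_covert_capacity: "covert_achievable_NCT QS W x0 R \<Longrightarrow> ereal R \<le> covert_capacity_NCT QS W x0"
  unfolding covert_capacity_NCT_def by (intro Sup_upper) auto

locale gelfand_pinsker =
  fixes QS :: "'s pmf" and W :: "'x \<Rightarrow> 's \<Rightarrow> ('y::finite \<times> 'z::finite) pmf" and x0 :: 'x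
    and p :: "'t pmf" and k :: "'t \<Rightarrow> 's pmf" and x :: "'t \<Rightarrow> 's \<Rightarrow> 'x"
  assumes full_support: "set_pmf (innocent_out QS W x0) = UNIV"
    and fin_p: "finite (set_pmf p)" and fin_k: "\<And>t. finite (set_pmf (k t))"
    and state_law: "bind_pmf p k = QS"
    and warden_law: "bind_pmf p (marginal_channel k (\<lambda>t s. warden_channel W (x t s) s))
        = innocent_out QS W x0"
begin

abbreviation "IS \<equiv> channel_mutual_inf p k"
abbreviation "IY \<equiv> channel_mutual_inf p (marginal_channel k (\<lambda>t s. receiver_channel W (x t s) s))"
abbreviation "IZ \<equiv> channel_mutual_inf p (marginal_channel k (\<lambda>t s. warden_channel W (x t s) s))"

lemma fin_QS: "finite (set_pmf QS)"
  using fin_p fin_k by (simp flip: state_law)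

theorem covert_achievable:
  assumes "0 \<le> R" "IZ - IS < R" "R < IY - IS"
  shows "covert_achievable_NCT QS W x0 R"
proof -
  let ?source = "\<lambda>n. pair_pmf (pmf_of_set {..<num_msgs n R}) (iid_pmf n QS)"
  let ?wy = "\<lambda>t s. receiver_channel W (x t s) s" and ?wz = "\<lambda>t s. warden_channel W (x t s) s"
  obtain f D where lengths: "\<And>n m s. length (f n m s) = n" and
    small: "exponentially_small (\<lambda>n. code_cost (?source n) (memoryless ?wy) (memoryless ?wz)
      (iid_pmf n (innocent_out QS W x0)) (f n) (D n))"
    using ex_block_codes[of p k ?wy ?wz R] fin_p fin_k assms unfolding state_law warden_law by auto
  define enc where "enc = (\<lambda>n m s. map2 x (f n m s) s)"
  have "code_cost (?source n) (memoryless (receiver_channel W)) (memoryless (warden_channel W)) q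
      (enc n) (D n)
      = code_cost (?source n) (memoryless ?wy) (memoryless ?wz) q (f n) (D n)" for n q
    by (simp add: code_cost_def enc_def memoryless_map2)
  thus ?thesis
    using full_support fin_QS small lengths
    by (intro covert_achievable_NCTI[where enc = enc and dec = D]) (auto simp: enc_def)
qed

theorem rate_le_covert_capacity:
  assumes "IZ < IY" "0 \<le> IY - IS"
  shows "ereal (IY - IS) \<le> covert_capacity_NCT QS W x0"
proof (cases "IY - IS = 0")
  case True
  thus ?thesis using covert_achievable_zero[OF full_support fin_QS]
    by (simp add: le_covert_capacity)
next
  case False
  show ?thesis
  proof (rule dense_le_bounded)
    show "ereal (max 0 (IZ - IS)) < ereal (IY - IS)" using False assms by simp
    fix r assume "ereal (max 0 (IZ - IS)) < r" "r < ereal (IY - IS)"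
    then obtain R where "r = ereal R" "0 \<le> R" "IZ - IS < R" "R < IY - IS"
      by (cases r) auto
    thus "r \<le> covert_capacity_NCT QS W x0"
      by (simp add: le_covert_capacity covert_achievable)
  qed
qed

end

lemma mutual_inf_eq_channel_mutual_inf:
  assumes "map_pmf (\<lambda>w. (F w, G w)) P = joint_pmf p k"
  shows "mutual_inf P F G = channel_mutual_inf p k"
  by (simp add: mutual_inf_map_pmf[of P] assms channel_mutual_inf_def)

lemma map_nct_joint_eq_joint_pmf:
  fixes PS :: "nat \<Rightarrow> nat \<Rightarrow> 's pmf" and W :: "'x \<Rightarrow> 's \<Rightarrow> ('y \<times> 'z) pmf"
  shows "map_pmf (\<lambda>w. (jUV w, jS w)) (nct_joint PU PV PS xf W)
      = joint_pmf (pair_pmf PU PV) (case_prod PS)"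
    and "map_pmf (\<lambda>w. (jUV w, jY w)) (nct_joint PU PV PS xf W) = joint_pmf (pair_pmf PU PV)
      (marginal_channel (case_prod PS) (\<lambda>t s. receiver_channel W (xf (fst t) s) s))"
    and "map_pmf (\<lambda>w. (jUV w, jZ w)) (nct_joint PU PV PS xf W) = joint_pmf (pair_pmf PU PV)
      (marginal_channel (case_prod PS) (\<lambda>t s. warden_channel W (xf (fst t) s) s))"
  by (simp_all add: nct_joint_def joint_pmf_def marginal_channel_def[abs_def] pair_pmf_def
      bind_assoc_pmf bind_return_pmf map_bind_pmf pmf.map_comp o_def case_prod_unfold)
    (simp add: map_pmf_def)

lemmas mutual_inf_nct_joint = map_nct_joint_eq_joint_pmf[THEN mutual_inf_eq_channel_mutual_inf]

lemma map_nct_joint_eq_bind_pmf: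
  fixes PS :: "nat \<Rightarrow> nat \<Rightarrow> 's pmf" and W :: "'x \<Rightarrow> 's \<Rightarrow> ('y \<times> 'z) pmf"
  shows "map_pmf jS (nct_joint PU PV PS xf W) = bind_pmf (pair_pmf PU PV) (case_prod PS)"
    and "map_pmf jZ (nct_joint PU PV PS xf W) = bind_pmf (pair_pmf PU PV)
      (marginal_channel (case_prod PS) (\<lambda>t s. warden_channel W (xf (fst t) s) s))"
  using map_nct_joint_eq_joint_pmf(1,3)[of PU PV PS xf W, THEN arg_cong[where f = "map_pmf snd"]]
  by (simp_all add: map_snd_joint_pmf pmf.map_comp o_def)

lemma finite_set_in_D_NCT:
  assumes "in_D_NCT QS W x0 PU PV PS xf"
  shows "finite (set_pmf PU)" "finite (set_pmf PV)"
  using assms by (auto simp: in_D_NCT_def Let_def intro: finite_subset)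

lemma gelfand_pinsker_if_in_D_NCT:
  fixes QS :: "'s::finite pmf" and W :: "'x::finite \<Rightarrow> 's \<Rightarrow> ('y::finite \<times> 'z::finite) pmf"
  assumes "set_pmf (innocent_out QS W x0) = UNIV" "in_D_NCT QS W x0 PU PV PS xf"
  shows "gelfand_pinsker QS W x0 (pair_pmf PU PV) (case_prod PS) (\<lambda>t. xf (fst t))"
proof
  show "finite (set_pmf (pair_pmf PU PV))"
    using finite_set_in_D_NCT[OF assms(2)] by simp
qed (use assms in \<open>simp_all add: in_D_NCT_def Let_def map_nct_joint_eq_bind_pmf\<close>)

lemma mutual_inf_chain_nct_joint:
  fixes PS :: "nat \<Rightarrow> nat \<Rightarrow> 's::finite pmf" and W :: "'x \<Rightarrow> 's \<Rightarrow> ('y::finite \<times> 'z::finite) pmf"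
  assumes fin: "finite (set_pmf PU)" "finite (set_pmf PV)" and P_def: "P = nct_joint PU PV PS xf W"
  shows "mutual_inf P jUV jY = mutual_inf P jU jY + cond_mutual_inf P jV jY jU"
proof -
  have jUV_eq: "jUV = (\<lambda>w :: nat \<times> nat \<times> 's \<times> 'x \<times> 'y \<times> 'z. (jU w, jV w))" by auto
  have "finite (set_pmf P)" using fin by (simp add: P_def nct_joint_def)
  thus ?thesis unfolding jUV_eq by (rule mutual_inf_chain)
qed

theorem theorem4:
  fixes QS :: "'s::finite pmf"
    and W :: "'x::finite \<Rightarrow> 's \<Rightarrow> ('y::finite \<times> 'z::finite) pmf"
    and x0 :: 'x
  assumes "set_pmf (innocent_out QS W x0) = UNIV"
  shows "Sup (ereal ` rate_set_NCT QS W x0) \<le> covert_capacity_NCT QS W x0"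
proof (rule SUP_least)
  fix R assume "R \<in> rate_set_NCT QS W x0"
  then obtain PU PV PS xf P where P_def: "P = nct_joint PU PV PS xf W" and "0 \<le> R"
    and in_D: "in_D_NCT QS W x0 PU PV PS xf"
    and R_le: "R \<le> mutual_inf P jU jY
      - max (mutual_inf P jU jS) (mutual_inf P jUV jS - cond_mutual_inf P jV jY jU)"
    by (auto simp: rate_set_NCT_def Let_def)
  interpret gelfand_pinsker QS W x0 "pair_pmf PU PV" "case_prod PS" "\<lambda>t. xf (fst t)"
    using assms in_D by (rule gelfand_pinsker_if_in_D_NCT)
  have chain: "mutual_inf P jUV jY = mutual_inf P jU jY + cond_mutual_inf P jV jY jU"
    by (rule mutual_inf_chain_nct_joint[OF finite_set_in_D_NCT[OF in_D] P_def])
  have "R \<le> mutual_inf P jUV jY - mutual_inf P jUV jS"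
    using R_le chain by simp
  hence R_le_GP: "R \<le> IY - IS"
    by (simp add: P_def mutual_inf_nct_joint)
  have "mutual_inf P jUV jZ < mutual_inf P jUV jY"
    using in_D chain by (simp add: in_D_NCT_def Let_def P_def)
  hence "IZ < IY"
    by (simp add: P_def mutual_inf_nct_joint)
  hence "ereal (IY - IS) \<le> covert_capacity_NCT QS W x0"
    using \<open>0 \<le> R\<close> R_le_GP by (intro rate_le_covert_capacity) auto
  thus "ereal R \<le> covert_capacity_NCT QS W x0"
    using R_le_GP by (simp add: order_trans[rotated])
qed

end
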